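(* Let $O_1,O_2,O_3,O_4\in \mathrm{SO}(3)$ satisfy the closure equation $O_4O_3O_2O_1=\mathrm{e}$. Choose one of the two couples of faces $(24)$ or $(13)$, and let $(P_1,P_2,P_3,P_4)$ be the correspondingly labelled quadruple (so $P_4P_3P_2P_1=\mathrm e$). Assume that the Gram matrix $\mathrm{Gram}(O_\ell)$ determined by this choice is defined and satisfies $\det \mathrm{Gram}(O_\ell)\neq 0$. Then there exists a generalized (i.e. possibly two-sheeted in the hyperbolic case) constantly curved convex tetrahedron, of curvature $\sigma\in\{+1,-1\}$, with labelled vertices $V_1,\dots,V_4$ and with the orientation agreeing with that of the simple paths, such that $P_1,P_2,P_3,P_4$ are the Levi-Civita holonomies around its four faces along the simple paths; that is, there is an orientation-preserving linear isometry $F:T_{V_4}\to\mathbb{R}^3$ with $$P_\ell = F\circ h_\ell\circ F^{-1},\qquad \ell=1,2,3,4 .$$ (This means in particular that $P_\ell=\exp\{\sigma\, a_\ell\,\hat n_\ell\cdot\vec J\,\}$, where $a_\ell\in(0,2\pi)$ is the area, possibly understood as a holonomy area, of face $\ell$, and $\hat n_\ell\in\mathbb{R}^3$ is the image under $F$ of the outward-pointing unit normal to face $\ell$ transported to $V_4$ along the simple path.) Moreover the tetrahedron is unique modulo isometries: $\sigma$ is uniquely determined, and any two such labelled tetrahedra are related by a linear map $\Lambda$ of $\mathbb{R}^4$ with $\det\Lambda=1$ that preserves $g_\sigma$.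
   Context: **Labelling by the choice of special couple.** For the choice $(24)$ put $(P_1,P_2,P_3,P_4)=(O_1,O_2,O_3,O_4)$. For the choice $(13)$ put $(P_1,P_2,P_3,P_4)=(O_4,O_1,O_2,O_3)$, i.e. the same construction is applied after a cyclic relabelling. In both cases $P_4P_3P_2P_1=\mathrm e$. Faces and vertices below are labelled according to the $P_\ell$. **Gram matrix of the group elements.** Suppose every $P_\ell\ne \mathrm e$, and let $\hat n_\ell\in\mathbb{R}^3$ be a unit vector on the rotation axis of $P_\ell$ (so $P_\ell\hat n_\ell=\hat n_\ell$; it is determined up to sign). The signs are fixed by requiring $$(\hat n_1\times\hat n_2)\cdot\hat n_3>0,\quad (\hat n_1\times\hat n_3)\cdot\hat n_4>0,\quad (\hat n_2\times\hat n_1)\cdot P_1\hat n_4>0,\quad (\hat n_3\times\hat n_2)\cdot P_3^{-1}\hat n_4>0 .$$ If all four triple products are nonzero, exactly one of the $2^4$ sign choices satisfies this. $\mathrm{Gram}(O_\ell)$ is said to be defined when all $P_\ell\neq\mathrm e$ and all four triple products are nonzero. It is then the symmetric $4\times4$ matrix with $\mathrm{Gram}_{\ell\ell}=1$, $\mathrm{Gram}_{\ell m}=\hat n_\ell\cdot\hat n_m$ for $\ell\ne m$, $\{\ell,m\}\neq\{2,4\}$, and $\mathrm{Gram}_{24}=\hat n_2\cdot P_1\hat n_4=\hat n_2\cdot P_3^{-1}\hat n_4$ (the two expressions agree by the closure equation). **Generalized constantly curved convex tetrahedra.** For $\sigma=\pm1$ let $g_\sigma=\mathrm{diag}(\sigma,1,1,1)$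 on $\mathbb{R}^4$, write $\langle x,y\rangle=x^Tg_\sigma y$, and let $M_\sigma=\{x\in\mathbb{R}^4:\langle x,x\rangle=\sigma\}$. This is the unit sphere $S^3$ for $\sigma=1$ and the unit two-sheeted hyperboloid for $\sigma=-1$. A generalized convex tetrahedron of curvature $\sigma$ is given by four linearly independent vertices $V_1,\dots,V_4\in M_\sigma$. The tetrahedron is the intersection of $M_\sigma$ with the convex cone $\{\sum_\ell c_\ell V_\ell : c_\ell\ge 0\}$. Face $\ell$ (opposite to vertex $\ell$) and the edges are the intersections of $M_\sigma$ with the cones spanned by the corresponding vertices. For $\sigma=-1$ the tetrahedron (or a face) is two-sheeted if its vertices do not all lie on one sheet; an edge joining vertices on different sheets is a generalized geodesic passing through infinity. The outward normal of face $\ell$ is the vector $N_\ell$ with $\langle N_\ell,N_\ell\rangle=1$, $\langle N_\ell,V_m\rangle=0$ for $m\neq\ell$, and $\langle N_\ell,V_\ell\rangle<0$; it is tangent to $M_\sigma$ at each $V_m$, $m\ne\ell$. **Orientation.** For $x\in M_\sigma$ let $T_x=\{v:\langle v,x\rangle=0\}$, a positive definite inner product space under $g_\sigma$. A basis $(v_1,v_2,v_3)$ of $T_x$ is positively oriented iff $\det(v_1,v_2,v_3,x)>0$. The tetrahedron's orientation agrees with that of the simple paths iff $\det(V_1,V_2,V_3,V_4)<0$ (equivalently, each face is traversed counterclockwise as seen from outside). $\mathbb{R}^3$ carries its standard inner product and orientation. **Parallel transport along edges.** For $\ell\neq m$ let $u_{\ell m}\in T_{V_\ell}$ be the positive normalization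 to unit length of $V_m-\sigma\langle V_m,V_\ell\rangle V_\ell$ (the unit velocity at $V_\ell$ of the edge going from $V_\ell$ to $V_m$). The transport $o_{m\ell}:T_{V_\ell}\to T_{V_m}$ from $V_\ell$ to $V_m$ is the linear isometry sending $u_{\ell m}\mapsto -u_{m\ell}$ and acting as the identity on the $g_\sigma$-orthogonal complement of $\mathrm{span}(V_\ell,V_m)$. When the edge lies in $S^3$ or in one sheet, this is the Levi-Civita parallel transport along it; otherwise it is the definition of parallel transport through infinity. One has $o_{\ell m}=o_{m\ell}^{-1}$. **Holonomies along the simple paths** (composition to the left, based at $V_4$, with special edge joining vertices 2 and 4): $$h_1=o_{43}o_{32}o_{24},\quad h_2=o_{41}o_{13}o_{34},\quad h_3=o_{42}o_{21}o_{14},\quad h_4=o_{42}\,[\,o_{23}o_{31}o_{12}\,]\,o_{24}.$$ The outward normals transported to $V_4$ are $N_1,N_2,N_3\in T_{V_4}$ for faces $1,2,3$, and $o_{42}N_4$ for face $4$. **Areas.** Let $\alpha_1,\alpha_2,\alpha_3$ be the internal angles of a face, the angle at a vertex $V_\ell$ being the angle in $(0,\pi)$ between the unit vectors $u_{\ell m}$ and $u_{\ell q}$ of its two sides. The area of the face is $\sum\alpha_n-\pi$ if $\sigma=1$, and $\pi-\sum\alpha_n$ if $\sigma=-1$ and the face lies in one sheet. If $\sigma=-1$ and the face is two-sheeted, its holonomy area is defined as $3\pi-\sum\alpha_n$. **Rotations.** $\vec J=(J^1,J^2,J^3)$ are the generators of $\mathfrak{so}(3)$ with $(\hat n\cdot\vec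 J)v=\hat n\times v$, so $\exp\{a\,\hat n\cdot\vec J\}$ is the right-handed rotation by angle $a$ about $\hat n$. *)

theory Defs
  imports "HOL-Analysis.Analysis"
begin

text \<open>
  Faces, vertices and group elements are labelled by the four-element type \<^typ>\<open>4\<close>, whose
  elements are written \<open>1, 2, 3, 4\<close>. Arithmetic in this type is modulo four, so \<open>4 = 0\<close> there.
\<close>

definition quad :: "'a \<Rightarrow> 'a \<Rightarrow> 'a \<Rightarrow> 'a \<Rightarrow> 4 \<Rightarrow> 'a" where
  "quad a b c d l = (if l = 1 then a else if l = 2 then b else if l = 3 then c else d)"

lemma quad_simps [simp]:
  "quad a b c d 1 = a" "quad a b c d 2 = b" "quad a b c d 3 = c" "quad a b c d 4 = d"
  by (simp_all add: quad_def)


section \<open>The special couple and the Gram matrix of four rotations\<close>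

datatype couple = Couple24 | Couple13

primrec relabel :: "couple \<Rightarrow> (4 \<Rightarrow> 'a) \<Rightarrow> 4 \<Rightarrow> 'a" where
  "relabel Couple24 Q = quad (Q 1) (Q 2) (Q 3) (Q 4)"
| "relabel Couple13 Q = quad (Q 4) (Q 1) (Q 2) (Q 3)"

definition unit_axes :: "(4 \<Rightarrow> real^3^3) \<Rightarrow> (4 \<Rightarrow> real^3) \<Rightarrow> bool" where
  "unit_axes P n \<longleftrightarrow> (\<forall>l. norm (n l) = 1 \<and> P l *v n l = n l)"

definition triple_products :: "(4 \<Rightarrow> real^3^3) \<Rightarrow> (4 \<Rightarrow> real^3) \<Rightarrow> 4 \<Rightarrow> real" where
  "triple_products P n = quad
     (cross3 (n 1) (n 2) \<bullet> n 3)
     (cross3 (n 1) (n 3) \<bullet> n 4)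
     (cross3 (n 2) (n 1) \<bullet> (P 1 *v n 4))
     (cross3 (n 3) (n 2) \<bullet> (matrix_inv (P 3) *v n 4))"

text \<open>For rotations different from the identity the unit axes exist and are determined up to
  sign, so whether the triple products vanish does not depend on the choice of \<open>n\<close>.\<close>

definition gram_defined :: "(4 \<Rightarrow> real^3^3) \<Rightarrow> bool" where
  "gram_defined P \<longleftrightarrow> (\<forall>l. P l \<noteq> mat 1) \<and>
     (\<exists>n. unit_axes P n \<and> (\<forall>i. triple_products P n i \<noteq> 0))"

definition signed_axes :: "(4 \<Rightarrow> real^3^3) \<Rightarrow> 4 \<Rightarrow> real^3" where
  "signed_axes P = (THE n. unit_axes P n \<and> (\<forall>i. triple_products P n i > 0))"

definition gram :: "(4 \<Rightarrow> real^3^3) \<Rightarrow> real^4^4" where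
  "gram P = (let n = signed_axes P in
     (\<chi> l m. if l = m then 1
            else if {l, m} = {2, 4} then n 2 \<bullet> (P 1 *v n 4)
            else n l \<bullet> n m))"

lemma gram_24_alt:
  assumes rot: "\<And>l. rotation_matrix (P l)"
    and closure: "P 4 ** P 3 ** P 2 ** P 1 = mat 1" and n: "unit_axes P n"
  shows "n 2 \<bullet> (P 1 *v n 4) = n 2 \<bullet> (matrix_inv (P 3) *v n 4)"
proof -
  have T: "transpose (P l) ** P l = mat 1" "P l ** transpose (P l) = mat 1" for l
    using rot[of l] by (auto simp: rotation_matrix_def orthogonal_matrix_def)
  have inv: "matrix_inv (P l) = transpose (P l)" for l
    unfolding matrix_inv_def
  proof (rule some_equality)
    fix B assume "P l ** B = mat 1 \<and> B ** P l = mat 1"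
    then show "B = transpose (P l)"
      by (metis T(2) matrix_mul_assoc matrix_mul_lid matrix_mul_rid)
  qed (use T in simp)
  have fixt: "transpose (P l) *v n l = n l" for l
    by (metis n unit_axes_def T(1) matrix_vector_mul_assoc matrix_vector_mul_lid)
  have "P 1 = transpose (P 2) ** (transpose (P 3) ** transpose (P 4))"
  proof -
    have "P 1 = transpose (P 2) ** (transpose (P 3) ** (transpose (P 4)
                  ** (P 4 ** P 3 ** P 2 ** P 1)))"
      by (metis T(1) matrix_mul_assoc matrix_mul_lid)
    thus ?thesis by (simp add: closure)
  qed
  hence "P 1 *v n 4 = transpose (P 2) *v (transpose (P 3) *v n 4)"
    by (metis fixt matrix_vector_mul_assoc)
  hence "n 2 \<bullet> (P 1 *v n 4) = (P 2 *v n 2) \<bullet> (transpose (P 3) *v n 4)"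
    by (metis dot_lmul_matrix inner_commute transpose_matrix_vector transpose_transpose)
  thus ?thesis
    using n by (simp add: inv unit_axes_def)
qed


section \<open>Curved tetrahedra\<close>

text \<open>The distinguished (for \<open>\<sigma> = -1\<close>: timelike) coordinate of \<^typ>\<open>real^4\<close> is coordinate \<open>1\<close>.\<close>

definition metric :: "real \<Rightarrow> real^4^4" where
  "metric \<sigma> = (\<chi> i j. if i = j then (if i = 1 then \<sigma> else 1) else 0)"

definition ip :: "real \<Rightarrow> real^4 \<Rightarrow> real^4 \<Rightarrow> real" where
  "ip \<sigma> x y = x \<bullet> (metric \<sigma> *v y)"

definition model_space :: "real \<Rightarrow> (real^4) set" where
  "model_space \<sigma> = {x. ip \<sigma> x x = \<sigma>}"

definition tangent_space :: "real \<Rightarrow> real^4 \<Rightarrow> (real^4) set" where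
  "tangent_space \<sigma> x = {v. ip \<sigma> v x = 0}"

definition curved_tetrahedron :: "real \<Rightarrow> (4 \<Rightarrow> real^4) \<Rightarrow> bool" where
  "curved_tetrahedron \<sigma> V \<longleftrightarrow> (\<sigma> = 1 \<or> \<sigma> = -1) \<and> (\<forall>l. V l \<in> model_space \<sigma>) \<and>
     inj V \<and> independent (range V)"

definition path_oriented :: "(4 \<Rightarrow> real^4) \<Rightarrow> bool" where
  "path_oriented V \<longleftrightarrow> det (vector [V 1, V 2, V 3, V 4] :: real^4^4) < 0"

definition outward_normal :: "real \<Rightarrow> (4 \<Rightarrow> real^4) \<Rightarrow> 4 \<Rightarrow> real^4" where
  "outward_normal \<sigma> V l = (THE N. ip \<sigma> N N = 1 \<and> (\<forall>m. m \<noteq> l \<longrightarrow> ip \<sigma> N (V m) = 0)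
     \<and> ip \<sigma> N (V l) < 0)"

text \<open>Unit velocity at \<open>x\<close> of the (generalized) geodesic edge from \<open>x\<close> to \<open>y\<close>.\<close>

definition edge_dir :: "real \<Rightarrow> real^4 \<Rightarrow> real^4 \<Rightarrow> real^4" where
  "edge_dir \<sigma> x y = (let w = y - (\<sigma> * ip \<sigma> y x) *\<^sub>R x in w /\<^sub>R sqrt (ip \<sigma> w w))"

text \<open>
  Transport from \<open>x\<close> to \<open>y\<close>. A tangent vector at \<open>x\<close> is the sum of its component along the unit
  vector \<open>edge_dir \<sigma> x y\<close>, which is sent to \<open>- edge_dir \<sigma> y x\<close>, and of a vector orthogonal to
  \<open>x\<close> and \<open>y\<close>, which is fixed; see lemma \<open>transport_characterization\<close>. Values outside the tangent
  space at \<open>x\<close> are irrelevant.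
\<close>

definition transport :: "real \<Rightarrow> real^4 \<Rightarrow> real^4 \<Rightarrow> real^4 \<Rightarrow> real^4" where
  "transport \<sigma> x y v = v - ip \<sigma> v (edge_dir \<sigma> x y) *\<^sub>R (edge_dir \<sigma> x y + edge_dir \<sigma> y x)"

lemma ip_expand: "ip \<sigma> x y = \<sigma> * (x$1 * y$1) + x$2 * y$2 + x$3 * y$3 + x$4 * y$4"
  by (simp add: ip_def metric_def inner_vec_def sum_4 matrix_vector_mult_def)

lemma ip_commute: "ip \<sigma> x y = ip \<sigma> y x"
  by (simp add: ip_expand)

lemma ip_linear [simp]:
  "ip \<sigma> (x + y) z = ip \<sigma> x z + ip \<sigma> y z" "ip \<sigma> (x - y) z = ip \<sigma> x z - ip \<sigma> y z"
  "ip \<sigma> (c *\<^sub>R x) z = c * ip \<sigma> x z" "ip \<sigma> (- x) z = - ip \<sigma> x z"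
  "ip \<sigma> z (x + y) = ip \<sigma> z x + ip \<sigma> z y" "ip \<sigma> z (x - y) = ip \<sigma> z x - ip \<sigma> z y"
  "ip \<sigma> z (c *\<^sub>R x) = c * ip \<sigma> z x" "ip \<sigma> z (- x) = - ip \<sigma> z x"
  by (simp_all add: ip_expand algebra_simps)

lemma tangent_space_pos:
  assumes "\<sigma> = 1 \<or> \<sigma> = -1" "x \<in> model_space \<sigma>" "v \<in> tangent_space \<sigma> x" "v \<noteq> 0"
  shows "ip \<sigma> v v > 0"
proof (cases "\<sigma> = 1")
  case True
  then have "metric \<sigma> = mat 1"
    by (simp add: metric_def mat_def vec_eq_iff)
  then show ?thesis
    using assms(4) by (simp add: ip_def)
next
  case False
  with assms have \<sigma>: "\<sigma> = -1" by blast
  define a b c d where abcd: "a = x$1" "b = x$2" "c = x$3" "d = x$4"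
  define p q r s where pqrs: "p = v$1" "q = v$2" "r = v$3" "s = v$4"
  have x: "a\<^sup>2 = 1 + b\<^sup>2 + c\<^sup>2 + d\<^sup>2"
    using assms(2) by (simp add: model_space_def ip_expand \<sigma> abcd power2_eq_square)
  have v: "p * a = q * b + r * c + s * d"
    using assms(3) by (simp add: tangent_space_def ip_expand \<sigma> abcd pqrs)
  have lagrange: "a\<^sup>2 * (q\<^sup>2 + r\<^sup>2 + s\<^sup>2 - p\<^sup>2)
      = (q\<^sup>2 + r\<^sup>2 + s\<^sup>2) + (q * c - r * b)\<^sup>2 + (q * d - s * b)\<^sup>2 + (r * d - s * c)\<^sup>2"
  proof -
    have "a\<^sup>2 * (q\<^sup>2 + r\<^sup>2 + s\<^sup>2 - p\<^sup>2)
        = (1 + b\<^sup>2 + c\<^sup>2 + d\<^sup>2) * (q\<^sup>2 + r\<^sup>2 + s\<^sup>2) - (q * b + r * c + s * d)\<^sup>2"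
      unfolding x[symmetric] v[symmetric] by (simp add: algebra_simps power2_eq_square)
    thus ?thesis by (simp add: algebra_simps power2_eq_square)
  qed
  have a: "a\<^sup>2 > 0"
    unfolding x by (smt (verit) zero_le_power2)
  have "q \<noteq> 0 \<or> r \<noteq> 0 \<or> s \<noteq> 0"
  proof (rule ccontr)
    assume "\<not> ?thesis"
    with v a have "p = 0" "q = 0" "r = 0" "s = 0" by auto
    with assms(4) show False by (simp add: vec_eq_iff forall_4 pqrs)
  qed
  hence "q\<^sup>2 + r\<^sup>2 + s\<^sup>2 > 0"
    by (smt (verit) zero_le_power2 zero_less_power2)
  hence "a\<^sup>2 * (q\<^sup>2 + r\<^sup>2 + s\<^sup>2 - p\<^sup>2) > 0"
    unfolding lagrange by (smt (verit) zero_le_power2)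
  with a have "q\<^sup>2 + r\<^sup>2 + s\<^sup>2 - p\<^sup>2 > 0"
    by (simp add: zero_less_mult_iff)
  thus ?thesis by (simp add: ip_expand \<sigma> pqrs power2_eq_square)
qed

lemma edge_dir_unit_tangent:
  assumes \<sigma>: "\<sigma> = 1 \<or> \<sigma> = -1" and x: "x \<in> model_space \<sigma>" and ne: "\<And>c. y \<noteq> c *\<^sub>R x"
  shows "edge_dir \<sigma> x y \<in> tangent_space \<sigma> x"
    and "ip \<sigma> (edge_dir \<sigma> x y) (edge_dir \<sigma> x y) = 1"
    and "\<And>v. ip \<sigma> v x = 0 \<Longrightarrow> ip \<sigma> v y = 0 \<Longrightarrow> ip \<sigma> v (edge_dir \<sigma> x y) = 0"
proof -
  define w where "w = y - (\<sigma> * ip \<sigma> y x) *\<^sub>R x"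
  have e: "edge_dir \<sigma> x y = w /\<^sub>R sqrt (ip \<sigma> w w)"
    by (simp add: edge_dir_def w_def Let_def)
  have w: "ip \<sigma> w x = 0"
    using x \<sigma> by (auto simp: w_def model_space_def)
  moreover have "w \<noteq> 0" using ne by (simp add: w_def)
  ultimately have pos: "ip \<sigma> w w > 0"
    using tangent_space_pos[OF \<sigma> x, of w] by (simp add: tangent_space_def)
  show "edge_dir \<sigma> x y \<in> tangent_space \<sigma> x" by (simp add: e tangent_space_def w)
  show "ip \<sigma> (edge_dir \<sigma> x y) (edge_dir \<sigma> x y) = 1"
    using pos by (simp add: e field_simps)
  show "ip \<sigma> v (edge_dir \<sigma> x y) = 0" if "ip \<sigma> v x = 0" "ip \<sigma> v y = 0" for v
    using that by (simp add: e w_def)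
qed

lemma transport_characterization:
  assumes "\<sigma> = 1 \<or> \<sigma> = -1" "x \<in> model_space \<sigma>" "\<And>c. y \<noteq> c *\<^sub>R x"
  shows "linear (transport \<sigma> x y)"
    and "transport \<sigma> x y (edge_dir \<sigma> x y) = - edge_dir \<sigma> y x"
    and "\<And>v. ip \<sigma> v x = 0 \<Longrightarrow> ip \<sigma> v y = 0 \<Longrightarrow> transport \<sigma> x y v = v"
proof -
  show "linear (transport \<sigma> x y)"
    by (rule linearI) (simp_all add: transport_def algebra_simps)
  show "transport \<sigma> x y (edge_dir \<sigma> x y) = - edge_dir \<sigma> y x"
    using edge_dir_unit_tangent(2)[OF assms] by (simp add: transport_def)
  show "transport \<sigma> x y v = v" if "ip \<sigma> v x = 0" "ip \<sigma> v y = 0" for v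
    using edge_dir_unit_tangent(3)[OF assms that] by (simp add: transport_def)
qed

text \<open>\<open>edge_transport \<sigma> V m l\<close> goes from vertex \<open>l\<close> to vertex \<open>m\<close>, so that transports compose
  to the left.\<close>

definition edge_transport :: "real \<Rightarrow> (4 \<Rightarrow> real^4) \<Rightarrow> 4 \<Rightarrow> 4 \<Rightarrow> real^4 \<Rightarrow> real^4" where
  "edge_transport \<sigma> V m l = transport \<sigma> (V l) (V m)"

definition holonomy :: "real \<Rightarrow> (4 \<Rightarrow> real^4) \<Rightarrow> 4 \<Rightarrow> real^4 \<Rightarrow> real^4" where
  "holonomy \<sigma> V = (let t = edge_transport \<sigma> V in quad
     (t 4 3 \<circ> t 3 2 \<circ> t 2 4)
     (t 4 1 \<circ> t 1 3 \<circ> t 3 4)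
     (t 4 2 \<circ> t 2 1 \<circ> t 1 4)
     (t 4 2 \<circ> (t 2 3 \<circ> t 3 1 \<circ> t 1 2) \<circ> t 2 4))"

definition transported_normal :: "real \<Rightarrow> (4 \<Rightarrow> real^4) \<Rightarrow> 4 \<Rightarrow> real^4" where
  "transported_normal \<sigma> V = quad (outward_normal \<sigma> V 1) (outward_normal \<sigma> V 2)
     (outward_normal \<sigma> V 3) (edge_transport \<sigma> V 4 2 (outward_normal \<sigma> V 4))"

definition corner_angle :: "real \<Rightarrow> real^4 \<Rightarrow> real^4 \<Rightarrow> real^4 \<Rightarrow> real" where
  "corner_angle \<sigma> x y z = arccos (ip \<sigma> (edge_dir \<sigma> x y) (edge_dir \<sigma> x z))"

definition one_sheeted :: "(real^4) set \<Rightarrow> bool" where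
  "one_sheeted S \<longleftrightarrow> (\<forall>x\<in>S. x$1 > 0) \<or> (\<forall>x\<in>S. x$1 < 0)"

definition triangle_area :: "real \<Rightarrow> real^4 \<Rightarrow> real^4 \<Rightarrow> real^4 \<Rightarrow> real" where
  "triangle_area \<sigma> x y z =
     (let s = corner_angle \<sigma> x y z + corner_angle \<sigma> y z x + corner_angle \<sigma> z x y in
      if \<sigma> = 1 then s - pi
      else if one_sheeted {x, y, z} then pi - s
      else 3 * pi - s)"

definition face_area :: "real \<Rightarrow> (4 \<Rightarrow> real^4) \<Rightarrow> 4 \<Rightarrow> real" where
  "face_area \<sigma> V = quad
     (triangle_area \<sigma> (V 2) (V 3) (V 4)) (triangle_area \<sigma> (V 1) (V 3) (V 4))
     (triangle_area \<sigma> (V 1) (V 2) (V 4)) (triangle_area \<sigma> (V 1) (V 2) (V 3))"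


section \<open>Holonomies as rotations of three-space\<close>

text \<open>\<open>F\<close> is taken to be linear on all of \<^typ>\<open>real^4\<close>; every linear map on the tangent space
  extends, and only the values on the tangent space are used.\<close>

definition oriented_frame :: "real \<Rightarrow> real^4 \<Rightarrow> (real^4 \<Rightarrow> real^3) \<Rightarrow> bool" where
  "oriented_frame \<sigma> x F \<longleftrightarrow> linear F \<and> bij_betw F (tangent_space \<sigma> x) UNIV \<and>
     (\<forall>v\<in>tangent_space \<sigma> x. \<forall>w\<in>tangent_space \<sigma> x. F v \<bullet> F w = ip \<sigma> v w) \<and>
     (\<forall>v1\<in>tangent_space \<sigma> x. \<forall>v2\<in>tangent_space \<sigma> x. \<forall>v3\<in>tangent_space \<sigma> x.
        det (vector [v1, v2, v3, x] :: real^4^4) > 0 \<longrightarrow>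
        det (vector [F v1, F v2, F v3] :: real^3^3) > 0)"

definition realizes :: "real \<Rightarrow> (4 \<Rightarrow> real^4) \<Rightarrow> (real^4 \<Rightarrow> real^3) \<Rightarrow> (4 \<Rightarrow> real^3^3) \<Rightarrow> bool" where
  "realizes \<sigma> V F P \<longleftrightarrow> curved_tetrahedron \<sigma> V \<and> path_oriented V \<and> oriented_frame \<sigma> (V 4) F \<and>
     (\<forall>l. (*v) (P l) = F \<circ> holonomy \<sigma> V l \<circ> inv_into (tangent_space \<sigma> (V 4)) F)"

text \<open>The matrix of \<open>n \<bullet> J\<close>, where \<open>J\<close> are the generators of so(3).\<close>

definition so3_generator :: "real^3 \<Rightarrow> real^3^3" where
  "so3_generator n = matrix (cross3 n)"

definition matrix_exp :: "real^'n^'n \<Rightarrow> real^'n^'n" where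
  "matrix_exp A = (\<Sum>k. (1 / fact k) *\<^sub>R (((**) A ^^ k) (mat 1)))"

definition isometry_matrix :: "real \<Rightarrow> real^4^4 \<Rightarrow> bool" where
  "isometry_matrix \<sigma> L \<longleftrightarrow> det L = 1 \<and> (\<forall>x y. ip \<sigma> (L *v x) (L *v y) = ip \<sigma> x y)"

end

theory Submission
  imports Defs
begin

text \<open>
  The transports around a face compose to a rotation about its normal, whose angle is the angle sum
  of the face minus \<open>\<pi>\<close>; the dual cosine rule locates that angle sum. Hence the transported normals of
  a tetrahedron are axes of its holonomies, they satisfy the four sign conditions, and the Gram matrix
  of the holonomies is the Gram matrix of the normals. This matrix determines the curvature (by its
  signature) and the normals, and hence the tetrahedron, up to isometry. Conversely, normals with the
  prescribed Gram matrix exist. The holonomies of the resulting tetrahedron have the same axes and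
  Gram matrix as the given rotations, and by the closure equation these data determine the rotations.
\<close>

section \<open>Linear algebra with the metric\<close>

text \<open>The edge 24 lies in faces 1 and 3, so transport along it fixes \<open>N 1\<close> and
  \<open>N 3\<close>, and \<open>t 4 2 (N 4)\<close> has the same products with them as
  \<open>N 4\<close>. For the product with \<open>N 2\<close> the vector \<open>N 4\<close> has to
  reach vertex 4 along an edge of face 2, which is 34 or 14. The results are
  \<open>P 1 *v n 4\<close> and \<open>matrix_inv (P 3) *v n 4\<close>; hence the 24 entry of the
  Gram matrix and the last two sign conditions. The curvature comes from a Schur complement. The
  normals 1, 2, 3 span the Euclidean tangent space at vertex 4, and the prescribed products fix the
  tangential part \<open>m\<close> of the fourth normal. Unit length leaves
  \<open>\<sigma> * s\<^sup>2 = 1 - m \<bullet> m\<close> for the remaining component. The right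
  side is det Gram divided by the Gram determinant of the first three axes, so det Gram decides both
  that \<open>s\<close> is nonzero and which \<open>\<sigma>\<close> occurs. A rotation determines
  its angle only modulo a full turn. This is why the angle sum must be compared with pi, and why a
  two-sheeted face, whose sum exceeds pi, has area \<open>3 * pi\<close> minus the sum.\<close>

definition vol :: "real^4 \<Rightarrow> real^4 \<Rightarrow> real^4 \<Rightarrow> real^4 \<Rightarrow> real" where
  "vol a b c d = det (vector [a, b, c, d] :: real^4^4)"

lemma vector_nth_4 [simp]:
  "(vector [a, b, c, d] :: 'a::zero^4) $ 1 = a" "(vector [a, b, c, d] :: 'a^4) $ 2 = b"
  "(vector [a, b, c, d] :: 'a^4) $ 3 = c" "(vector [a, b, c, d] :: 'a^4) $ 4 = d"
  by (simp_all add: vector_def)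

lemma det_4:
  fixes A :: "'a::comm_ring_1^4^4"
  shows "det A =
      A$1$1 * (A$2$2 * (A$3$3 * A$4$4 - A$3$4 * A$4$3) - A$2$3 * (A$3$2 * A$4$4 - A$3$4 * A$4$2)
             + A$2$4 * (A$3$2 * A$4$3 - A$3$3 * A$4$2))
    - A$1$2 * (A$2$1 * (A$3$3 * A$4$4 - A$3$4 * A$4$3) - A$2$3 * (A$3$1 * A$4$4 - A$3$4 * A$4$1)
             + A$2$4 * (A$3$1 * A$4$3 - A$3$3 * A$4$1))
    + A$1$3 * (A$2$1 * (A$3$2 * A$4$4 - A$3$4 * A$4$2) - A$2$2 * (A$3$1 * A$4$4 - A$3$4 * A$4$1)
             + A$2$4 * (A$3$1 * A$4$2 - A$3$2 * A$4$1))
    - A$1$4 * (A$2$1 * (A$3$2 * A$4$3 - A$3$3 * A$4$2) - A$2$2 * (A$3$1 * A$4$3 - A$3$3 * A$4$1)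
             + A$2$3 * (A$3$1 * A$4$2 - A$3$2 * A$4$1))"
proof -
  have f1: "finite {2::4, 3, 4}" "1 \<notin> {2::4, 3, 4}" by auto
  have f2: "finite {3::4, 4}" "2 \<notin> {3::4, 4}" by auto
  have f3: "finite {4::4}" "3 \<notin> {4::4}" by auto
  show ?thesis
    unfolding det_def UNIV_4
    unfolding sum_over_permutations_insert[OF f1]
    unfolding sum_over_permutations_insert[OF f2]
    unfolding sum_over_permutations_insert[OF f3]
    unfolding permutes_sing
    by (simp add: sign_swap_id permutation_swap_id permutation_compose sign_compose sign_id swap_id_eq algebra_simps)
qed

lemma vol_expand: "vol x y z w =
      x$1 * (y$2 * (z$3 * w$4 - z$4 * w$3) - y$3 * (z$2 * w$4 - z$4 * w$2) + y$4 * (z$2 * w$3 - z$3 * w$2))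
    - x$2 * (y$1 * (z$3 * w$4 - z$4 * w$3) - y$3 * (z$1 * w$4 - z$4 * w$1) + y$4 * (z$1 * w$3 - z$3 * w$1))
    + x$3 * (y$1 * (z$2 * w$4 - z$4 * w$2) - y$2 * (z$1 * w$4 - z$4 * w$1) + y$4 * (z$1 * w$2 - z$2 * w$1))
    - x$4 * (y$1 * (z$2 * w$3 - z$3 * w$2) - y$2 * (z$1 * w$3 - z$3 * w$1) + y$3 * (z$1 * w$2 - z$2 * w$1))"
  by (simp add: vol_def det_4)

lemma vol_linear [simp]:
  "vol (a + a') b c d = vol a b c d + vol a' b c d" "vol (a - a') b c d = vol a b c d - vol a' b c d"
  "vol (k *\<^sub>R a) b c d = k * vol a b c d"
  "vol a (b + b') c d = vol a b c d + vol a b' c d" "vol a (b - b') c d = vol a b c d - vol a b' c d"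
  "vol a (k *\<^sub>R b) c d = k * vol a b c d"
  "vol a b (c + c') d = vol a b c d + vol a b c' d" "vol a b (c - c') d = vol a b c d - vol a b c' d"
  "vol a b (k *\<^sub>R c) d = k * vol a b c d"
  "vol a b c (d + d') = vol a b c d + vol a b c d'" "vol a b c (d - d') = vol a b c d - vol a b c d'"
  "vol a b c (k *\<^sub>R d) = k * vol a b c d"
  "vol (- a) b c d = - vol a b c d" "vol a (- b) c d = - vol a b c d"
  "vol a b (- c) d = - vol a b c d" "vol a b c (- d) = - vol a b c d"
  by (simp_all add: vol_expand algebra_simps)

lemma vol_repeated [simp]:
  "vol a a c d = 0" "vol a b a d = 0" "vol a b c a = 0"
  "vol a b b d = 0" "vol a b c b = 0" "vol a b c c = 0"
  by (simp_all add: vol_expand algebra_simps)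

lemma vol_swap:
  "vol b a c d = - vol a b c d" "vol a c b d = - vol a b c d" "vol a b d c = - vol a b c d"
  by (simp_all add: vol_expand algebra_simps)

text \<open>The 4 by 4 minors of five vectors of \<open>real^4\<close> are the coefficients of a
  linear relation between them. Paired with a vector, it gives the scalar identity behind
  reflections, independence and face normals.\<close>

lemma cramer:
  "vol m v w x *\<^sub>R u + vol u m w x *\<^sub>R v + vol u v m x *\<^sub>R w + vol u v w m *\<^sub>R x = vol u v w x *\<^sub>R m"
  by (simp add: vec_eq_iff forall_4 vol_expand algebra_simps)

lemma ip_cramer:
  "ip \<sigma> u y * vol m v w x + ip \<sigma> v y * vol u m w x + ip \<sigma> w y * vol u v m x + ip \<sigma> x y * vol u v w m
   = ip \<sigma> m y * vol u v w x"
  using arg_cong[OF cramer[of m v w x u], of "\<lambda>z. ip \<sigma> z y"] by (simp add: mult.commute)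

text \<open>The Gram matrix is a product of the two coordinate matrices with the metric between
  them, whose determinant is \<open>\<sigma>\<close>. For vectors dual to each other it is
  triangular, which yields the signs of volumes later.\<close>

lemma vol_mult_vol: "\<sigma> * (vol a b c d * vol a' b' c' d') =
   det (vector [vector [ip \<sigma> a a', ip \<sigma> a b', ip \<sigma> a c', ip \<sigma> a d'],
                vector [ip \<sigma> b a', ip \<sigma> b b', ip \<sigma> b c', ip \<sigma> b d'],
                vector [ip \<sigma> c a', ip \<sigma> c b', ip \<sigma> c c', ip \<sigma> c d'],
                vector [ip \<sigma> d a', ip \<sigma> d b', ip \<sigma> d c', ip \<sigma> d d']] :: real^4^4)" (is "_ = det ?G")
proof -
  define A B where "A = (vector [a, b, c, d] :: real^4^4)" and "B = (vector [a', b', c', d'] :: real^4^4)"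
  have "det (metric \<sigma>) = \<sigma>"
    by (simp add: det_4 metric_def)
  moreover have "A ** metric \<sigma> ** transpose B = ?G"
    by (simp add: A_def B_def vec_eq_iff forall_4 matrix_matrix_mult_def metric_def transpose_def sum_4 ip_expand algebra_simps)
  moreover have "det (A ** metric \<sigma> ** transpose B) = det A * det (metric \<sigma>) * det B"
    by (simp add: det_mul)
  ultimately show ?thesis
    by (simp add: vol_def A_def B_def)
qed

lemma vol_matrix: "vol (L *v a) (L *v b) (L *v c) (L *v d) = det L * vol a b c d"
proof -
  have "(vector [L *v a, L *v b, L *v c, L *v d] :: real^4^4) = vector [a, b, c, d] ** transpose L"
    by (simp add: vec_eq_iff forall_4 matrix_matrix_mult_def transpose_def matrix_vector_mult_def sum_4 mult.commute)
  then show ?thesis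
    unfolding vol_def by (simp add: det_mul)
qed

lemma ip_zero [simp]: "ip \<sigma> 0 v = 0" "ip \<sigma> v 0 = 0"
  by (simp_all add: ip_expand)

lemma ip_nondegenerate:
  assumes "\<sigma> \<noteq> 0" "\<And>y. ip \<sigma> v y = 0"
  shows "v = 0"
  using assms(1) assms(2)[of "axis 1 1"] assms(2)[of "axis 2 1"] assms(2)[of "axis 3 1"] assms(2)[of "axis 4 1"]
  by (simp add: ip_expand vec_eq_iff forall_4 axis_def)

lemma vol_nonzero_imp_zero:
  assumes "\<sigma> \<noteq> 0" "vol a b c d \<noteq> 0" "ip \<sigma> v a = 0" "ip \<sigma> v b = 0" "ip \<sigma> v c = 0" "ip \<sigma> v d = 0"
  shows "v = 0"
proof (rule ip_nondegenerate[OF assms(1)])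
  fix y
  from assms ip_cramer[of \<sigma> a v y b c d] show "ip \<sigma> v y = 0" by (simp add: ip_commute)
qed

text \<open>Applying the metric to the given vectors reduces the claim to Euclidean orthogonality,
  whatever the signature.\<close>

lemma exists_orthogonal:
  assumes "\<sigma> = 1 \<or> \<sigma> = -1"
  obtains u where "u \<noteq> 0" "ip \<sigma> u a = 0" "ip \<sigma> u b = 0" "ip \<sigma> u c = 0"
proof -
  let ?g = "\<lambda>v. metric \<sigma> *v v"
  have "dim {?g a, ?g b, ?g c} < DIM(real^4)"
    using dim_le_card'[of "{?g a, ?g b, ?g c}"] by (simp add: card_insert_if split: if_splits)
  then obtain u where "u \<noteq> 0" "\<And>y. y \<in> span {?g a, ?g b, ?g c} \<Longrightarrow> orthogonal u y"
    using orthogonal_to_subspace_exists by blast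
  then show ?thesis
    using that[of u] by (simp add: ip_def orthogonal_def span_base)
qed

section \<open>Reflections and frames\<close>

text \<open>The metric reflection along \<open>m\<close>. For a null \<open>m\<close> the quotient
  is 0 and the map is the identity, hence the side condition
  \<open>ip \<sigma> m m \<noteq> 0\<close> below.\<close>

definition mirror :: "real \<Rightarrow> real^4 \<Rightarrow> real^4 \<Rightarrow> real^4" where
  "mirror \<sigma> m v = v - (2 * ip \<sigma> v m / ip \<sigma> m m) *\<^sub>R m"

lemma linear_mirror: "linear (mirror \<sigma> m)"
  by (rule linearI) (simp_all add: mirror_def scaleR_add_left scaleR_diff_right add_divide_distrib distrib_left)

lemma ip_mirror_self: "ip \<sigma> m m \<noteq> 0 \<Longrightarrow> ip \<sigma> (mirror \<sigma> m v) m = - ip \<sigma> v m"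
  by (simp add: mirror_def)

lemma ip_mirror [simp]:
  assumes "ip \<sigma> m m \<noteq> 0"
  shows "ip \<sigma> (mirror \<sigma> m u) (mirror \<sigma> m v) = ip \<sigma> u v"
proof -
  have "ip \<sigma> (mirror \<sigma> m u) (mirror \<sigma> m v) = ip \<sigma> (mirror \<sigma> m u) v + 2 * ip \<sigma> v m / ip \<sigma> m m * ip \<sigma> u m"
    by (subst (2) mirror_def) (simp add: ip_mirror_self[OF assms])
  then show ?thesis
    by (simp add: mirror_def ip_commute[of \<sigma> m v])
qed

lemma mirror_mirror [simp]:
  assumes "ip \<sigma> m m \<noteq> 0"
  shows "mirror \<sigma> m (mirror \<sigma> m v) = v"
proof -
  have "mirror \<sigma> m (mirror \<sigma> m v) = mirror \<sigma> m v + (2 * ip \<sigma> v m / ip \<sigma> m m) *\<^sub>R m"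
    by (subst (1) mirror_def) (simp add: ip_mirror_self[OF assms])
  then show ?thesis
    by (simp add: mirror_def)
qed

lemma mirror_fix: "ip \<sigma> v m = 0 \<Longrightarrow> mirror \<sigma> m v = v"
  by (simp add: mirror_def)

text \<open>By multilinearity only terms with at most one \<open>m\<close> survive, and
  \<open>ip_cramer\<close> sums the linear ones to twice the volume. This replaces a determinant
  computation for the reflection.\<close>

lemma vol_mirror:
  assumes "ip \<sigma> m m \<noteq> 0"
  shows "vol (mirror \<sigma> m u) (mirror \<sigma> m v) (mirror \<sigma> m w) (mirror \<sigma> m x) = - vol u v w x"
proof -
  define q where "q = ip \<sigma> m m"
  have "q * vol (mirror \<sigma> m u) (mirror \<sigma> m v) (mirror \<sigma> m w) (mirror \<sigma> m x)
     = q * vol u v w x - 2 * (ip \<sigma> u m * vol m v w x + ip \<sigma> v m * vol u m w x + ip \<sigma> w m * vol u v m x + ip \<sigma> x m * vol u v w m)"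
    using assms unfolding q_def[symmetric] by (simp add: mirror_def q_def[symmetric] field_simps)
  also have "\<dots> = q * (- vol u v w x)"
    by (simp add: ip_cramer[of \<sigma> u m m v w x] q_def)
  finally show ?thesis
    using assms unfolding q_def by (metis mult_left_cancel)
qed

section \<open>Oriented frames of tangent spaces\<close>

lemma frame_inner: "oriented_frame \<sigma> x F \<Longrightarrow> v \<in> tangent_space \<sigma> x \<Longrightarrow> w \<in> tangent_space \<sigma> x \<Longrightarrow> F v \<bullet> F w = ip \<sigma> v w"
  by (simp add: oriented_frame_def)

lemma frame_linear: "oriented_frame \<sigma> x F \<Longrightarrow> linear F"
  by (simp add: oriented_frame_def)

lemma frame_surj:
  assumes "oriented_frame \<sigma> x F"
  obtains v where "v \<in> tangent_space \<sigma> x" "F v = a"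
  using assms unfolding oriented_frame_def bij_betw_def by (metis UNIV_I imageE)

lemma frame_inj:
  "oriented_frame \<sigma> x F \<Longrightarrow> v \<in> tangent_space \<sigma> x \<Longrightarrow> w \<in> tangent_space \<sigma> x \<Longrightarrow> F v = F w \<Longrightarrow> v = w"
  unfolding oriented_frame_def bij_betw_def inj_on_def by blast

text \<open>\<open>oriented_frame\<close> prescribes only a sign for the determinant. Both sides
  have the same square, by the two Gram determinants, so the sign condition upgrades to equality; a
  negative volume is treated by exchanging \<open>u\<close> and \<open>v\<close>.\<close>

lemma frame_vol:
  assumes \<sigma>: "\<sigma> = 1 \<or> \<sigma> = -1" and x: "x \<in> model_space \<sigma>" and F: "oriented_frame \<sigma> x F"
    and u: "u \<in> tangent_space \<sigma> x" and v: "v \<in> tangent_space \<sigma> x" and w: "w \<in> tangent_space \<sigma> x"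
  shows "F u \<bullet> cross3 (F v) (F w) = vol u v w x"
proof -
  let ?d = "F u \<bullet> cross3 (F v) (F w)"
  have pos: "F a \<bullet> cross3 (F b) (F c) > 0"
    if "vol a b c x > 0" "a \<in> tangent_space \<sigma> x" "b \<in> tangent_space \<sigma> x" "c \<in> tangent_space \<sigma> x" for a b c
    using F that unfolding oriented_frame_def vol_def dot_cross_det by blast
  have t: "ip \<sigma> u x = 0" "ip \<sigma> v x = 0" "ip \<sigma> w x = 0" "ip \<sigma> x u = 0" "ip \<sigma> x v = 0" "ip \<sigma> x w = 0" "ip \<sigma> x x = \<sigma>"
    using u v w x by (simp_all add: tangent_space_def model_space_def ip_commute)
  have G: "?d\<^sup>2 = det (vector [vector [F u \<bullet> F u, F u \<bullet> F v, F u \<bullet> F w], vector [F v \<bullet> F u, F v \<bullet> F v, F v \<bullet> F w],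
          vector [F w \<bullet> F u, F w \<bullet> F v, F w \<bullet> F w]] :: real^3^3)"
    unfolding det_3 vector_3 cross3_def inner_vec_def sum_3 inner_real_def power2_eq_square by algebra
  have "\<sigma> * (vol u v w x * vol u v w x) = \<sigma> * ?d\<^sup>2"
    unfolding vol_mult_vol G det_3 det_4 vector_nth_4 vector_3 t frame_inner[OF F u v] frame_inner[OF F u w] frame_inner[OF F v w]
      frame_inner[OF F v u] frame_inner[OF F w u] frame_inner[OF F w v]
      frame_inner[OF F u u] frame_inner[OF F v v] frame_inner[OF F w w]
    by (simp add: algebra_simps)
  with \<sigma> have sq: "?d\<^sup>2 = (vol u v w x)\<^sup>2"
    by (auto simp: power2_eq_square)
  consider "vol u v w x > 0" | "vol u v w x = 0" | "vol v u w x > 0"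
    using vol_swap(1)[of v u w x] by linarith
  then show ?thesis
  proof cases
    case 1
    then show ?thesis using pos[OF 1 u v w] sq by (simp add: power2_eq_iff)
  next
    case 2
    then show ?thesis using sq by simp
  next
    case 3
    have "F v \<bullet> cross3 (F u) (F w) = - ?d"
      by (simp add: cross3_simps)
    then show ?thesis using pos[OF 3 v u w] sq vol_swap(1)[of v u w x] 3 by (simp add: power2_eq_iff)
  qed
qed

text \<open>The reflection along \<open>x + y\<close> sends \<open>y\<close> to \<open>- x\<close>.
  It reverses volumes, and the sign of the base point reverses them once more, so the frame carried
  from \<open>x\<close> to \<open>y\<close> stays oriented.\<close>

lemma frame_mirror:
  assumes \<sigma>: "\<sigma> = 1 \<or> \<sigma> = -1" and x: "x \<in> model_space \<sigma>" and y: "y \<in> model_space \<sigma>" and ne: "ip \<sigma> (x + y) (x + y) \<noteq> 0"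
    and F: "oriented_frame \<sigma> x F"
  shows "oriented_frame \<sigma> y (F \<circ> mirror \<sigma> (x + y))"
proof -
  let ?R = "mirror \<sigma> (x + y)"
  have xy: "ip \<sigma> x x = \<sigma>" "ip \<sigma> y y = \<sigma>" using x y by (simp_all add: model_space_def)
  have "2 * ip \<sigma> x (x + y) = ip \<sigma> (x + y) (x + y)" "2 * ip \<sigma> y (x + y) = ip \<sigma> (x + y) (x + y)"
    using xy by (simp_all add: ip_commute[of \<sigma> y x])
  then have Rx: "?R x = - y" and Ry: "?R y = - x"
    using ne by (simp_all add: mirror_def del: ip_linear)
  have t: "?R v \<in> tangent_space \<sigma> x" if "v \<in> tangent_space \<sigma> y" for v
    using ip_mirror[OF ne, of v y] that by (simp add: tangent_space_def Ry)
  have t': "?R v \<in> tangent_space \<sigma> y" if "v \<in> tangent_space \<sigma> x" for v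
    using ip_mirror[OF ne, of v x] that by (simp add: tangent_space_def Rx)
  have "bij_betw ?R (tangent_space \<sigma> y) (tangent_space \<sigma> x)"
    by (rule bij_betw_byWitness[where f' = ?R]) (auto simp: mirror_mirror[OF ne] t t')
  then have "bij_betw (F \<circ> ?R) (tangent_space \<sigma> y) UNIV"
    using F bij_betw_trans unfolding oriented_frame_def by blast
  moreover have "det (vector [F (?R v1), F (?R v2), F (?R v3)] :: real^3^3) > 0"
    if "v1 \<in> tangent_space \<sigma> y" "v2 \<in> tangent_space \<sigma> y" "v3 \<in> tangent_space \<sigma> y" "vol v1 v2 v3 y > 0" for v1 v2 v3
  proof -
    have "vol (?R v1) (?R v2) (?R v3) (- x) < 0"
      using vol_mirror[OF ne, of v1 v2 v3 y] that by (simp add: Ry)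
    then have "vol (?R v1) (?R v2) (?R v3) x > 0" by simp
    then show ?thesis
      using F that t unfolding oriented_frame_def vol_def by blast
  qed
  ultimately show ?thesis
    using F t unfolding oriented_frame_def vol_def
    by (simp add: linear_compose[OF linear_mirror] ip_mirror[OF ne])
qed

section \<open>Rotations of three-space\<close>

lemma triple_decomp:
  "(a \<bullet> cross3 b c) *\<^sub>R v = (v \<bullet> cross3 b c) *\<^sub>R a + (v \<bullet> cross3 c a) *\<^sub>R b + (v \<bullet> cross3 a b) *\<^sub>R c"
  by (simp add: vec_eq_iff forall_3 cross3_def inner_vec_def sum_3 algebra_simps)

lemma matrix_eq_on_triple:
  fixes P Q :: "real^3^3"
  assumes "a \<bullet> cross3 b c \<noteq> 0" "P *v a = Q *v a" "P *v b = Q *v b" "P *v c = Q *v c"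
  shows "P = Q"
proof (rule matrix_eq[THEN iffD2], rule allI)
  fix v
  have "(a \<bullet> cross3 b c) *\<^sub>R (P *v v) = P *v ((a \<bullet> cross3 b c) *\<^sub>R v)"
    by (simp add: matrix_vector_mult_scaleR)
  also have "\<dots> = Q *v ((a \<bullet> cross3 b c) *\<^sub>R v)"
    unfolding triple_decomp[of a b c v]
    by (simp only: matrix_vector_right_distrib matrix_vector_mult_scaleR assms)
  finally show "P *v v = Q *v v"
    using assms(1) by (simp add: matrix_vector_mult_scaleR)
qed

lemma rotation_inner:
  fixes P :: "real^3^3"
  assumes "rotation_matrix P"
  shows "(P *v a) \<bullet> (P *v b) = a \<bullet> b"
proof -
  have "(P *v a) \<bullet> (P *v b) = (transpose P *v (P *v a)) \<bullet> b"
    by (simp add: dot_lmul_matrix)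
  then show ?thesis
    using assms by (simp add: rotation_matrix_def orthogonal_matrix_def matrix_vector_mul_assoc
        del: transpose_matrix_vector)
qed

lemma rotation_norm: "rotation_matrix (P :: real^3^3) \<Longrightarrow> norm (P *v a) = norm a"
  by (simp add: norm_eq_sqrt_inner rotation_inner)

lemma rotation_mult: "rotation_matrix (P :: real^3^3) \<Longrightarrow> rotation_matrix Q \<Longrightarrow> rotation_matrix (P ** Q)"
  by (simp add: rotation_matrix_def orthogonal_matrix_mul det_mul)

lemma rotation_right_cancel:
  fixes M :: "real^3^3"
  assumes "rotation_matrix M" "P ** M = Q ** M"
  shows "P = Q"
  using assms unfolding rotation_matrix_def orthogonal_matrix_def
  by (metis matrix_mul_assoc matrix_mul_rid)

lemma rotation_inv:
  fixes P :: "real^3^3"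
  assumes "rotation_matrix P"
  shows "P *v (matrix_inv P *v v) = v" "matrix_inv P *v (P *v v) = v"
proof -
  have "P ** matrix_inv P = mat 1 \<and> matrix_inv P ** P = mat 1"
    unfolding matrix_inv_def
    by (rule someI[of _ "transpose P"]) (use assms in \<open>auto simp: rotation_matrix_def orthogonal_matrix_def\<close>)
  then show "P *v (matrix_inv P *v v) = v" "matrix_inv P *v (P *v v) = v"
    by (simp_all add: matrix_vector_mul_assoc)
qed

text \<open>Rotations commute with \<open>cross3\<close>, so the image of a third basis vector is
  known too.\<close>

lemma rotation_eqI:
  assumes P: "rotation_matrix P" and Q: "rotation_matrix Q"
    and ab: "cross3 a b \<noteq> 0" and a: "P *v a = Q *v a" and b: "P *v b = Q *v b"
  shows "P = Q"
proof (rule matrix_eq_on_triple[of "cross3 a b" a b])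
  show "P *v cross3 a b = Q *v cross3 a b"
    using cross_rotation_matrix[OF P] cross_rotation_matrix[OF Q] a b by metis
qed (use assms in auto)

lemma cross_nonzero: "cross3 a b \<bullet> c \<noteq> 0 \<Longrightarrow> cross3 a c \<noteq> 0"
proof -
  have "cross3 a b \<bullet> c = - (cross3 a c \<bullet> b)" by (simp add: cross3_simps)
  then show "cross3 a b \<bullet> c \<noteq> 0 \<Longrightarrow> cross3 a c \<noteq> 0" by auto
qed

text \<open>The two products fix the component in the plane of \<open>a\<close> and
  \<open>b\<close>; the length then fixes the component along \<open>cross3 a b\<close> up to
  sign.\<close>

lemma unit_vector_eqI:
  fixes m m' :: "real^3"
  assumes "norm m = 1" "norm m' = 1" "m \<bullet> a = m' \<bullet> a" "m \<bullet> b = m' \<bullet> b"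
    "cross3 a b \<bullet> m > 0" "cross3 a b \<bullet> m' > 0"
  shows "m = m'"
proof -
  define c where "c = cross3 a b"
  have cc: "c \<bullet> c > 0"
    using assms(5) by (metis c_def inner_gt_zero_iff inner_zero_left less_irrefl)
  have d: "(m - m') \<bullet> cross3 b c = 0" "(m - m') \<bullet> cross3 c a = 0"
  proof -
    have "cross3 b c = (b \<bullet> b) *\<^sub>R a - (a \<bullet> b) *\<^sub>R b" "cross3 c a = (a \<bullet> a) *\<^sub>R b - (a \<bullet> b) *\<^sub>R a"
      by (simp_all add: c_def vec_eq_iff forall_3 cross3_def inner_vec_def sum_3 algebra_simps)
    then show "(m - m') \<bullet> cross3 b c = 0" "(m - m') \<bullet> cross3 c a = 0"
      using assms(3,4) by (simp_all add: inner_diff_left inner_diff_right)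
  qed
  have "a \<bullet> cross3 b c = c \<bullet> c"
    unfolding c_def by (simp add: cross3_simps)
  with d have e: "(c \<bullet> c) *\<^sub>R (m - m') = ((m - m') \<bullet> c) *\<^sub>R c"
    using triple_decomp[of a b c "m - m'"] by (simp flip: c_def)
  \<comment> \<open>The difference is a multiple of \<open>c\<close> and, by equal lengths,
    orthogonal to the sum, which has a positive product with \<open>c\<close>. So the multiple is
    zero.\<close>
  have "(m - m') \<bullet> (m + m') = 0"
    using assms(1,2) by (simp add: algebra_simps inner_commute norm_eq_1)
  then have "((m - m') \<bullet> c) * (c \<bullet> (m + m')) = 0"
    using arg_cong[OF e, of "\<lambda>z. z \<bullet> (m + m')"] by simp
  moreover have "c \<bullet> (m + m') > 0"
    using assms(5,6) by (simp add: c_def inner_add_right)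
  ultimately show ?thesis
    using e cc by simp
qed

text \<open>This is rotation about a unit vector \<open>n\<close> only for \<open>e\<close>
  orthogonal to \<open>n\<close>; in general the axial part would be missing.\<close>

definition turn :: "real^3 \<Rightarrow> real \<Rightarrow> real^3 \<Rightarrow> real^3" where
  "turn n \<theta> e = cos \<theta> *\<^sub>R e + sin \<theta> *\<^sub>R cross3 n e"

lemma cross_cross_unit:
  assumes "norm n = 1" "n \<bullet> e = 0"
  shows "cross3 n (cross3 n e) = - e"
proof -
  have "cross3 n (cross3 n e) = (n \<bullet> e) *\<^sub>R n - (n \<bullet> n) *\<^sub>R e"
    by (simp add: vec_eq_iff forall_3 cross3_def inner_vec_def sum_3 algebra_simps)
  with assms show ?thesis by (simp add: norm_eq_1)
qed

lemma turn_turn: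
  assumes "norm n = 1" "n \<bullet> e = 0"
  shows "turn n a (turn n b e) = turn n (a + b) e"
  by (simp add: turn_def cross_add_right cross_mult_right cross_cross_unit[OF assms] cos_add sin_add algebra_simps)

lemma turn_minus: "turn n a (- e) = - turn n a e"
  by (simp add: turn_def)

lemma turn_minus_pi: "turn n (a - pi) e = - turn n a e"
  by (simp add: turn_def sin_diff cos_diff)

text \<open>\<open>arccos\<close> forgets the sense of rotation; the positive triple product says
  that the turn from \<open>e\<close> to \<open>f\<close> is counterclockwise about
  \<open>n\<close>, and excludes the angles 0 and pi.\<close>

lemma turn_arccos:
  assumes n: "norm n = 1" and e: "norm e = 1" and f: "norm f = 1" and ne: "n \<bullet> e = 0" and nf: "n \<bullet> f = 0"
    and pos: "n \<bullet> cross3 e f > 0"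
  shows "f = turn n (arccos (e \<bullet> f)) e" "0 < arccos (e \<bullet> f)" "arccos (e \<bullet> f) < pi"
proof -
  define g where "g = cross3 n e"
  have g: "g \<bullet> g = 1" "g \<bullet> e = 0" "g \<bullet> n = 0"
    unfolding g_def using norm_cross_dot[of n e] n e ne
    by (simp_all add: dot_cross_self power2_norm_eq_inner)
  have "n \<bullet> cross3 e g = g \<bullet> g" "f \<bullet> g = n \<bullet> cross3 e f"
    unfolding g_def by (simp_all add: cross3_simps)
  moreover have "cross3 e g = n"
  proof -
    have "cross3 e g = (e \<bullet> e) *\<^sub>R n - (n \<bullet> e) *\<^sub>R e"
      unfolding g_def by (simp add: vec_eq_iff forall_3 cross3_def inner_vec_def sum_3 algebra_simps)
    with e ne show ?thesis by (simp add: norm_eq_1)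
  qed
  moreover have "cross3 g n = e"
    using cross_cross_unit[OF n ne] cross_skew[of g n] by (simp add: g_def)
  ultimately have dec: "f = (f \<bullet> e) *\<^sub>R e + (f \<bullet> g) *\<^sub>R g" and fg: "f \<bullet> g > 0"
    using triple_decomp[of n e g f] nf pos g by (simp_all add: inner_commute g_def[symmetric])
  have "f \<bullet> f = (f \<bullet> e) * (f \<bullet> e) + (f \<bullet> g) * (f \<bullet> g)"
    using arg_cong[OF dec, of "\<lambda>z. f \<bullet> z"] by (simp add: inner_add_right)
  then have sq: "(f \<bullet> g)\<^sup>2 = 1 - (e \<bullet> f)\<^sup>2"
    using f by (simp add: norm_eq_1 power2_eq_square inner_commute)
  with fg have "(e \<bullet> f)\<^sup>2 < 1"
    by (smt (verit) zero_less_power2)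
  then have b: "\<bar>e \<bullet> f\<bar> < 1"
    by (simp add: abs_square_less_1)
  then have "sin (arccos (e \<bullet> f)) = f \<bullet> g"
    using sq fg sin_arccos[of "e \<bullet> f"] by (metis abs_le_iff abs_less_iff le_less real_sqrt_unique minus_le_iff)
  moreover have "cos (arccos (e \<bullet> f)) = e \<bullet> f"
    using b by (simp add: abs_less_iff)
  ultimately show "f = turn n (arccos (e \<bullet> f)) e"
    using dec by (simp add: turn_def g_def inner_commute)
  show "0 < arccos (e \<bullet> f)" "arccos (e \<bullet> f) < pi"
    using b arccos_lt_bounded[of "e \<bullet> f"] by (auto simp: abs_less_iff)
qed

section \<open>Rodrigues' formula and the matrix exponential\<close>

definition rodrigues :: "real^3 \<Rightarrow> real \<Rightarrow> real^3^3" where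
  "rodrigues n \<theta> = mat 1 + sin \<theta> *\<^sub>R so3_generator n + (1 - cos \<theta>) *\<^sub>R (so3_generator n ** so3_generator n)"

lemma so3_generator_mult: "so3_generator n *v v = cross3 n v"
proof -
  have "linear (cross3 n)"
    by (rule linearI) (simp_all add: cross_add_right cross_mult_right)
  then show ?thesis by (simp add: so3_generator_def matrix_works)
qed

lemma rodrigues_mult:
  "rodrigues n \<theta> *v v = v + sin \<theta> *\<^sub>R cross3 n v + (1 - cos \<theta>) *\<^sub>R cross3 n (cross3 n v)"
  by (simp add: rodrigues_def matrix_vector_mult_add_rdistrib scaleR_matrix_vector_assoc[symmetric]
      matrix_vector_mul_assoc[symmetric] so3_generator_mult)

lemma rotation_eq_rodrigues:
  assumes P: "rotation_matrix P" and n: "norm n = 1" and b: "norm b = 1" and nb: "n \<bullet> b = 0"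
    and Pn: "P *v n = n" and Pb: "P *v b = turn n \<theta> b"
  shows "P = rodrigues n \<theta>"
proof (rule matrix_eq_on_triple[of n b "cross3 n b"])
  have nnb: "n \<bullet> cross3 n b = 0" by (simp add: dot_cross_self)
  have "n \<bullet> cross3 b (cross3 n b) = (n \<bullet> n) * (b \<bullet> b) - (n \<bullet> b)\<^sup>2"
    by (simp add: cross3_simps power2_eq_square)
  then show "n \<bullet> cross3 b (cross3 n b) \<noteq> 0"
    using n b nb by (simp add: norm_eq_1)
  show "P *v n = rodrigues n \<theta> *v n"
    by (simp add: rodrigues_mult Pn)
  show "P *v b = rodrigues n \<theta> *v b"
    by (simp add: rodrigues_mult Pb turn_def cross_cross_unit[OF n nb] algebra_simps)
  have "P *v cross3 n b = turn n \<theta> (cross3 n b)"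
    using cross_rotation_matrix[OF P, of n b] Pn Pb
    by (simp add: turn_def cross_add_right cross_mult_right)
  then show "P *v cross3 n b = rodrigues n \<theta> *v cross3 n b"
    by (simp add: rodrigues_mult turn_def cross_cross_unit[OF n nnb] algebra_simps)
qed

lemma rodrigues_add_2pi: "rodrigues n (\<theta> + 2 * pi) = rodrigues n \<theta>"
  by (simp add: rodrigues_def)

text \<open>The cube of the generator is its negative, so odd powers collect to the sine series and
  positive even powers to the cosine series without its constant term.\<close>

lemma matrix_exp_generator:
  assumes n: "norm n = 1"
  shows "matrix_exp (\<theta> *\<^sub>R so3_generator n) = rodrigues n \<theta>"
proof -
  let ?G = "so3_generator n"
  let ?\<delta> = "\<lambda>k::nat. if k = 0 then 1 else 0 :: real"
  have GGG: "?G ** (?G ** ?G) = - ?G"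
  proof (rule matrix_eq[THEN iffD2], rule allI)
    fix v
    have "cross3 n (cross3 n (cross3 n v)) = - cross3 n v"
      using n by (intro cross_cross_unit) (simp_all add: dot_cross_self)
    then show "(?G ** (?G ** ?G)) *v v = - ?G *v v"

      using matrix_vector_mult_diff_rdistrib[of 0 ?G v]
      by (simp add: matrix_vector_mul_assoc[symmetric] so3_generator_mult)
  qed
  have sub: "?G ** (X - Y) = ?G ** X - ?G ** Y" for X Y :: "real^3^3"
    using matrix_add_ldistrib[of ?G "X - Y" Y] by simp
  have scal: "?G ** (r *\<^sub>R X) = r *\<^sub>R (?G ** X)" for r and X :: "real^3^3"
    by (simp add: matrix_scalar_ac scalar_matrix_assoc)
  \<comment> \<open>\<open>?\<delta>\<close> corrects \<open>k = 0\<close>: the zeroth power is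
    \<open>mat 1\<close>, whereas the pattern of the even powers would give minus the square of
    \<open>?G\<close>.\<close>
  have summand: "(1 / fact k) *\<^sub>R (((**) (\<theta> *\<^sub>R ?G) ^^ k) (mat 1))
      = (sin_coeff k * \<theta> ^ k) *\<^sub>R ?G - (cos_coeff k * \<theta> ^ k - ?\<delta> k) *\<^sub>R (?G ** ?G) + ?\<delta> k *\<^sub>R mat 1" for k
  proof (induction k)
    case 0
    then show ?case by simp
  next
    case (Suc k)
    have "(1 / fact (Suc k)) *\<^sub>R (((**) (\<theta> *\<^sub>R ?G) ^^ Suc k) (mat 1))
        = (\<theta> / Suc k) *\<^sub>R (?G ** ((1 / fact k) *\<^sub>R (((**) (\<theta> *\<^sub>R ?G) ^^ k) (mat 1))))"
      by (simp add: matrix_scalar_ac scalar_matrix_assoc[symmetric] divide_simps)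
    also have "\<dots> = (\<theta> / Suc k) *\<^sub>R ((sin_coeff k * \<theta> ^ k) *\<^sub>R (?G ** ?G) + (cos_coeff k * \<theta> ^ k - ?\<delta> k) *\<^sub>R ?G + ?\<delta> k *\<^sub>R ?G)"
      unfolding Suc by (simp add: matrix_add_ldistrib sub scal GGG)
    also have "\<dots> = (sin_coeff (Suc k) * \<theta> ^ Suc k) *\<^sub>R ?G - (cos_coeff (Suc k) * \<theta> ^ Suc k) *\<^sub>R (?G ** ?G)"
      by (simp add: sin_coeff_Suc cos_coeff_Suc algebra_simps)
    finally show ?case by simp
  qed
  have "(\<lambda>k. sin_coeff k * \<theta> ^ k) sums sin \<theta>" "(\<lambda>k. cos_coeff k * \<theta> ^ k) sums cos \<theta>" "?\<delta> sums 1"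
    using sin_converges[of \<theta>] cos_converges[of \<theta>] sums_If_finite[of "\<lambda>k. k = 0" "\<lambda>_. 1::real"] by simp_all
  then have "(\<lambda>k. (1 / fact k) *\<^sub>R (((**) (\<theta> *\<^sub>R ?G) ^^ k) (mat 1)))
      sums (sin \<theta> *\<^sub>R ?G - (cos \<theta> - 1) *\<^sub>R (?G ** ?G) + 1 *\<^sub>R mat 1)"
    unfolding summand
    by (intro sums_add sums_diff bounded_linear.sums[OF bounded_linear_scaleR_left])
  then show ?thesis
    by (simp add: matrix_exp_def rodrigues_def sums_iff algebra_simps)
qed

text \<open>A triangle seen in one frame: \<open>a1\<close>, \<open>a2\<close> are the velocities at
  the first corner, \<open>b\<close>, \<open>- a1\<close> those at the second, \<open>- a2\<close>,
  \<open>c\<close> those at the third. The three corner angles take \<open>b\<close> to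
  \<open>- a1\<close>, \<open>a1\<close> to \<open>a2\<close> and \<open>- a2\<close> to
  \<open>c\<close>. The sign changes between these turns leave one factor -1 against
  \<open>P *v b = - c\<close>, which is the \<open>- pi\<close>.\<close>

lemma turn_triangle:
  assumes n: "norm n = 1" and P: "rotation_matrix P" "P *v n = n" "P *v b = - c"
    and unit: "norm a1 = 1" "norm a2 = 1" "norm b = 1" "norm c = 1"
    and orth: "n \<bullet> a1 = 0" "n \<bullet> a2 = 0" "n \<bullet> b = 0" "n \<bullet> c = 0"
    and pos: "n \<bullet> cross3 a1 a2 > 0" "n \<bullet> cross3 b (- a1) > 0" "n \<bullet> cross3 (- a2) c > 0"
  shows "P = rodrigues n (arccos (a1 \<bullet> a2) + arccos (b \<bullet> (- a1)) + arccos ((- a2) \<bullet> c) - pi)"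
proof (rule rotation_eq_rodrigues[OF P(1) n unit(3) orth(3) P(2)])
  let ?\<alpha> = "arccos (a1 \<bullet> a2)" and ?\<beta> = "arccos (b \<bullet> (- a1))" and ?\<gamma> = "arccos ((- a2) \<bullet> c)"
  have a2: "a2 = turn n ?\<alpha> a1"
    using turn_arccos(1)[OF n unit(1,2) orth(1,2) pos(1)] .
  have "- a1 = turn n ?\<beta> b"
    by (rule turn_arccos(1)[OF n unit(3) _ orth(3) _ pos(2)]) (use unit orth in simp_all)
  then have a1: "a1 = - turn n ?\<beta> b"
    by (metis minus_minus)
  have c: "c = turn n ?\<gamma> (- a2)"
    by (rule turn_arccos(1)[OF n _ unit(4) _ orth(4) pos(3)]) (use unit orth in simp_all)
  have "- c = turn n ?\<gamma> (turn n ?\<alpha> a1)"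
    using c arg_cong[OF a2, of "turn n ?\<gamma>"] by (metis turn_minus minus_minus)
  also have "\<dots> = turn n (?\<gamma> + ?\<alpha>) a1"
    by (rule turn_turn[OF n orth(1)])
  also have "\<dots> = - turn n (?\<gamma> + ?\<alpha> + ?\<beta>) b"
    using arg_cong[OF a1, of "turn n (?\<gamma> + ?\<alpha>)"] by (simp only: turn_minus turn_turn[OF n orth(3)])
  also have "\<dots> = turn n (?\<gamma> + ?\<alpha> + ?\<beta> - pi) b"
    by (simp add: turn_minus_pi)
  also have "?\<gamma> + ?\<alpha> + ?\<beta> - pi = ?\<alpha> + ?\<beta> + ?\<gamma> - pi" by simp
  finally show "P *v b = turn n (?\<alpha> + ?\<beta> + ?\<gamma> - pi) b"
    by (simp add: P)
qed

section \<open>Rotations with prescribed axes\<close>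

definition closed_rotations :: "(4 \<Rightarrow> real^3^3) \<Rightarrow> bool" where
  "closed_rotations P \<longleftrightarrow> (\<forall>l. rotation_matrix (P l)) \<and> P 4 ** P 3 ** P 2 ** P 1 = mat 1"

definition positive_axes :: "(4 \<Rightarrow> real^3^3) \<Rightarrow> (4 \<Rightarrow> real^3) \<Rightarrow> bool" where
  "positive_axes P n \<longleftrightarrow> unit_axes P n \<and> (\<forall>i. triple_products P n i > 0)"

lemma triple_products_pos_iff:
  "(\<forall>i. triple_products P n i > 0) \<longleftrightarrow> cross3 (n 1) (n 2) \<bullet> n 3 > 0 \<and> cross3 (n 1) (n 3) \<bullet> n 4 > 0 \<and>
     cross3 (n 2) (n 1) \<bullet> (P 1 *v n 4) > 0 \<and> cross3 (n 3) (n 2) \<bullet> (matrix_inv (P 3) *v n 4) > 0"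
  by (simp add: forall_4 triple_products_def)

text \<open>\<open>P 4\<close> fixes \<open>n 4\<close>, hence so does the product of the other
  three.\<close>

lemma closure_23:
  assumes P: "closed_rotations P" and n: "unit_axes P n"
  shows "P 2 *v (P 1 *v n 4) = matrix_inv (P 3) *v n 4"
proof -
  have "P 4 *v (P 3 *v (P 2 *v (P 1 *v n 4))) = P 4 *v n 4"
    using P n by (simp add: closed_rotations_def matrix_vector_mul_assoc matrix_mul_assoc unit_axes_def)
  then have "P 3 *v (P 2 *v (P 1 *v n 4)) = n 4"
    using rotation_inv(2)[of "P 4"] P by (metis closed_rotations_def)
  then show ?thesis
    using rotation_inv(2)[of "P 3"] P by (metis closed_rotations_def)
qed

text \<open>The given data fix \<open>P 1 *v n 4\<close> and \<open>matrix_inv (P 3) *v n 4\<close>: two inner products, the length and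
  a sign. So \<open>P 1\<close> and \<open>P 3\<close> are known, and the closure equation yields the other two.\<close>

lemma positive_axes_determine:
  assumes P: "closed_rotations P" "positive_axes P n" and Q: "closed_rotations Q" "positive_axes Q n'"
    and eq: "n' 1 = n 1" "n' 2 = n 2" "n' 3 = n 3"
    and ip: "n' 1 \<bullet> n' 4 = n 1 \<bullet> n 4" "n' 3 \<bullet> n' 4 = n 3 \<bullet> n 4"
      "n' 2 \<bullet> (Q 1 *v n' 4) = n 2 \<bullet> (P 1 *v n 4)"
  shows "P = Q"
proof -
  have uP: "unit_axes P n" and uQ: "unit_axes Q n'"
    using P(2) Q(2) by (simp_all add: positive_axes_def)
  have rP: "rotation_matrix (P l)" and rQ: "rotation_matrix (Q l)" for l
    using P(1) Q(1) by (simp_all add: closed_rotations_def)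
  have nP: "P l *v n l = n l" "norm (n l) = 1" and nQ: "Q l *v n' l = n' l" "norm (n' l) = 1" for l
    using uP uQ by (simp_all add: unit_axes_def)
  have posP: "cross3 (n 1) (n 3) \<bullet> n 4 > 0" "cross3 (n 2) (n 1) \<bullet> (P 1 *v n 4) > 0"
       "cross3 (n 3) (n 2) \<bullet> (matrix_inv (P 3) *v n 4) > 0"
    and posQ: "cross3 (n 1) (n 3) \<bullet> n' 4 > 0" "cross3 (n 2) (n 1) \<bullet> (Q 1 *v n' 4) > 0"
       "cross3 (n 3) (n 2) \<bullet> (matrix_inv (Q 3) *v n' 4) > 0"
    using P(2) Q(2) by (simp_all add: positive_axes_def triple_products_pos_iff eq)
  have n4: "n' 4 = n 4"
    by (rule unit_vector_eqI[of _ _ "n 1" "n 3"]) (use posP posQ nP nQ ip eq in \<open>simp_all add: inner_commute\<close>)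
  have QP1: "Q 1 *v n 4 = P 1 *v n 4"
  proof (rule unit_vector_eqI[of _ _ "n 2" "n 1"])
    \<comment> \<open>Both rotations fix \<open>n 1\<close>, so each side is
      \<open>n 4 \<bullet> n 1\<close>; the product with \<open>n 2\<close> is the 24 entry of the
      Gram matrix.\<close>
    show "(Q 1 *v n 4) \<bullet> n 1 = (P 1 *v n 4) \<bullet> n 1"
      by (metis nP(1) nQ(1) eq(1) rP rQ rotation_inner)
  qed (use posP posQ nP rP rQ ip eq in \<open>simp_all add: inner_commute n4 rotation_norm\<close>)
  have c14: "cross3 (n 1) (n 4) \<noteq> 0"
    using cross_nonzero[of "n 1" "n 3" "n 4"] posP(1) by simp
  have P1: "P 1 = Q 1"
    by (rule rotation_eqI[OF rP rQ c14]) (use QP1 nP nQ eq in metis)+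
  let ?x = "matrix_inv (P 3) *v n 4" and ?y = "matrix_inv (Q 3) *v n 4"
  have Px: "P 3 *v ?x = n 4" and Qy: "Q 3 *v ?y = n 4"
    by (simp_all add: rotation_inv rP rQ)
  have xy: "?x = ?y"
  proof (rule unit_vector_eqI[of _ _ "n 3" "n 2"])
    show "norm ?x = 1" "norm ?y = 1"
      using rotation_norm[OF rP, of 3 ?x] rotation_norm[OF rQ, of 3 ?y] by (simp_all add: Px Qy nP)
    show "?x \<bullet> n 3 = ?y \<bullet> n 3"
      using rotation_inner[OF rP, of 3 ?x "n 3"] rotation_inner[OF rQ, of 3 ?y "n 3"] nP(1)[of 3] nQ(1)[of 3]
      by (simp add: Px Qy eq)
    have "n 2 \<bullet> ?x = n 2 \<bullet> (P 1 *v n 4)"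
      using gram_24_alt[of P n] rP P(1) uP by (simp add: closed_rotations_def)
    moreover have "n 2 \<bullet> ?y = n 2 \<bullet> (Q 1 *v n 4)"
      using gram_24_alt[of Q n'] rQ Q(1) uQ by (simp add: closed_rotations_def eq n4)
    ultimately show "?x \<bullet> n 2 = ?y \<bullet> n 2"
      by (simp add: QP1 inner_commute)
  qed (use posP posQ n4 in auto)
  have c3: "cross3 (n 3) ?x \<noteq> 0"
    using cross_nonzero[of "n 3" "n 2" ?x] posP(3) by simp
  have P3: "P 3 = Q 3"
    by (rule rotation_eqI[OF rP rQ c3]) (use Px Qy xy nP nQ eq in metis)+
  have c2: "cross3 (n 2) (P 1 *v n 4) \<noteq> 0"
    using cross_nonzero[of "n 2" "n 1" "P 1 *v n 4"] posP(2) by simp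
  \<comment> \<open>Besides its axis, \<open>P 2\<close> has a second known value: closure makes it
    send \<open>P 1 *v n 4\<close> to \<open>matrix_inv (P 3) *v n 4\<close>.\<close>
  have P2: "P 2 = Q 2"
  proof (rule rotation_eqI[OF rP rQ c2])
    show "P 2 *v n 2 = Q 2 *v n 2" using nP nQ eq by metis
    show "P 2 *v (P 1 *v n 4) = Q 2 *v (P 1 *v n 4)"
      using closure_23[OF P(1) uP] closure_23[OF Q(1) uQ] by (simp add: n4 P1 P3)
  qed
  have "P 4 ** (P 3 ** P 2 ** P 1) = Q 4 ** (P 3 ** P 2 ** P 1)"
    using P(1) Q(1) by (simp add: closed_rotations_def matrix_mul_assoc P1 P2 P3)
  then have "P 4 = Q 4"
    by (rule rotation_right_cancel[rotated]) (intro rotation_mult rP)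
  with P1 P2 P3 have "\<forall>l. P l = Q l" by (simp add: forall_4)
  then show ?thesis by auto
qed

text \<open>A rotation fixing two independent vectors is the identity, so the two axes are
  parallel.\<close>

lemma axis_unique_upto_sign:
  fixes P :: "real^3^3"
  assumes P: "rotation_matrix P" "P \<noteq> mat 1" and "P *v m = m" "P *v m' = m'" "norm m = 1" "norm m' = 1"
  obtains s where "s = 1 \<or> s = -1" "m' = s *\<^sub>R m"
proof -
  have "rotation_matrix (mat 1 :: real^3^3)"
    by (simp add: rotation_matrix_def orthogonal_matrix_id)
  then have "cross3 m m' = 0"
    using rotation_eqI[OF P(1), of "mat 1" m m'] assms by auto
  then have "(m' \<bullet> m) *\<^sub>R m = m'"
  proof -
    have "cross3 m (cross3 m m') = (m \<bullet> m') *\<^sub>R m - (m \<bullet> m) *\<^sub>R m'"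
      by (simp add: vec_eq_iff forall_3 cross3_def inner_vec_def sum_3 algebra_simps)
    with \<open>cross3 m m' = 0\<close> assms show ?thesis by (simp add: norm_eq_1 inner_commute)
  qed
  moreover from this have "\<bar>m' \<bullet> m\<bar> = 1"
    using assms(5,6) by (metis mult.right_neutral norm_scaleR)
  ultimately show ?thesis
    using that[of "m' \<bullet> m"] by (simp add: abs_if split: if_splits)
qed

lemma triple_products_scaled:
  "triple_products P (\<lambda>l. s l *\<^sub>R n l) = quad
     (s 1 * s 2 * s 3 * triple_products P n 1) (s 1 * s 3 * s 4 * triple_products P n 2)
     (s 1 * s 2 * s 4 * triple_products P n 3) (s 2 * s 3 * s 4 * triple_products P n 4)"
  by (simp add: triple_products_def cross_mult_left cross_mult_right matrix_vector_mult_scaleR ac_simps)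

text \<open>Each sign condition involves three of the four signs. The product of all four conditions
  has the sign of \<open>s 1 * s 2 * s 3 * s 4\<close>, and comparing it with each condition
  isolates one sign.\<close>

lemma positive_axes_unique:
  assumes P: "closed_rotations P" "\<forall>l. P l \<noteq> mat 1" and n: "positive_axes P n" and n': "positive_axes P n'"
  shows "n = n'"
proof -
  have "\<exists>s. (s = 1 \<or> s = -1) \<and> n' l = s *\<^sub>R n l" for l
    using axis_unique_upto_sign[of "P l" "n l" "n' l"] assms
    by (metis closed_rotations_def positive_axes_def unit_axes_def)
  then obtain s where s: "\<And>l. s l = 1 \<or> s l = (-1 :: real)" "\<And>l. n' l = s l *\<^sub>R n l"
    by metis
  then have n'_eq: "n' = (\<lambda>l. s l *\<^sub>R n l)" by auto
  have pos: "triple_products P n i > 0" "triple_products P n' i > 0" for i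
    using n n' by (simp_all add: positive_axes_def)
  have "s 1 * s 2 * s 3 > 0" "s 1 * s 3 * s 4 > 0" "s 1 * s 2 * s 4 > 0" "s 2 * s 3 * s 4 > 0"
    using pos(2)[of 1] pos(2)[of 2] pos(2)[of 3] pos(2)[of 4] pos(1)[of 1] pos(1)[of 2] pos(1)[of 3] pos(1)[of 4]
    unfolding n'_eq triple_products_scaled quad_simps by (meson zero_less_mult_pos2)+
  then have "\<forall>l. s l = 1"
    using s(1)[of 1] s(1)[of 2] s(1)[of 3] s(1)[of 4] unfolding forall_4 by auto
  with n'_eq show ?thesis by simp
qed

lemma signed_axes_positive:
  assumes P: "closed_rotations P" "gram_defined P"
  shows "positive_axes P (signed_axes P)"
proof -
  obtain n where n: "unit_axes P n" "\<And>i. triple_products P n i \<noteq> 0"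
    using P by (auto simp: gram_defined_def)
  define t where "t i = sgn (triple_products P n i)" for i
  \<comment> \<open>This solves the sign system of \<open>triple_products_scaled\<close>:
    \<open>s l\<close> is the product of the signs of those triple products in which axis
    \<open>l\<close> occurs.\<close>
  define s where "s = quad (t 1 * t 2 * t 3) (t 1 * t 3 * t 4) (t 1 * t 2 * t 4) (t 2 * t 3 * t 4)"
  have t: "t i * (t i * x) = x" "\<bar>t i\<bar> = 1" "t i * triple_products P n i > 0" "t i = 1 \<or> t i = -1" for i x
    using n(2)[of i] by (auto simp: t_def sgn_if)
  have s_unit: "\<bar>s l\<bar> = 1" for l
    by (simp add: s_def quad_def abs_mult t)
  have u: "unit_axes P (\<lambda>l. s l *\<^sub>R n l)"
    using n(1) by (simp add: unit_axes_def s_unit matrix_vector_mult_scaleR)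
  have "s 1 * s 2 * s 3 = t 1" "s 1 * s 3 * s 4 = t 2" "s 1 * s 2 * s 4 = t 3" "s 2 * s 3 * s 4 = t 4"
    using t(4)[of 1] t(4)[of 2] t(4)[of 3] t(4)[of 4] unfolding s_def quad_simps by auto
  then have "positive_axes P (\<lambda>l. s l *\<^sub>R n l)"
    unfolding positive_axes_def triple_products_scaled using u t(3) by (simp add: forall_4)
  then have "\<exists>!n. positive_axes P n"
    using positive_axes_unique P by (metis gram_defined_def)
  then show ?thesis
    unfolding signed_axes_def positive_axes_def[symmetric] by (rule theI')
qed

lemma relabel_closed:
  assumes "\<forall>l. rotation_matrix (Os l)" "Os 4 ** Os 3 ** Os 2 ** Os 1 = (mat 1 :: real^3^3)"
  shows "closed_rotations (relabel c Os)"
proof (cases c)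
  case Couple24
  with assms show ?thesis by (simp add: closed_rotations_def forall_4)
next
  case Couple13
  \<comment> \<open>A left inverse of a square matrix is a right inverse, which permits the cyclic
    shift.\<close>
  have "Os 3 ** Os 2 ** Os 1 ** Os 4 = mat 1"
    using assms(2) by (metis matrix_left_right_inverse matrix_mul_assoc)
  with Couple13 assms show ?thesis by (simp add: closed_rotations_def forall_4)
qed

section \<open>Transport and triangles\<close>

text \<open>The inequality makes the edge non-degenerate in both geometries at once. For
  \<open>\<sigma> = -1\<close> it leaves the sign of \<open>ip \<sigma> x y\<close> free, so edges
  through infinity are included.\<close>

definition edge :: "real \<Rightarrow> real^4 \<Rightarrow> real^4 \<Rightarrow> bool" where
  "edge \<sigma> x y \<longleftrightarrow> (\<sigma> = 1 \<or> \<sigma> = -1) \<and> x \<in> model_space \<sigma> \<and> y \<in> model_space \<sigma> \<and> \<sigma> * (1 - (ip \<sigma> x y)\<^sup>2) > 0"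

lemma edge_sym: "edge \<sigma> x y \<Longrightarrow> edge \<sigma> y x"
  by (simp add: edge_def ip_commute)

text \<open>The quantity in \<open>edge\<close> is the square length of the nonzero component of
  \<open>y\<close> tangent at \<open>x\<close>.\<close>

lemma edgeI:
  assumes "\<sigma> = 1 \<or> \<sigma> = -1" "x \<in> model_space \<sigma>" "y \<in> model_space \<sigma>" "\<And>c. y \<noteq> c *\<^sub>R x"
  shows "edge \<sigma> x y"
proof -
  define w where "w = y - (\<sigma> * ip \<sigma> y x) *\<^sub>R x"
  have "w \<noteq> 0" using assms(4) by (simp add: w_def)
  moreover have "ip \<sigma> w x = 0"
    using assms(1,2) by (auto simp: w_def model_space_def)
  moreover have "ip \<sigma> w w = \<sigma> * (1 - (ip \<sigma> x y)\<^sup>2)"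
    using assms(1-3) by (auto simp: w_def model_space_def ip_commute[of \<sigma> y x] power2_eq_square algebra_simps)
  ultimately show ?thesis
    using tangent_space_pos[of \<sigma> x w] assms by (simp add: edge_def tangent_space_def)
qed

text \<open>The sine of the edge length on the sphere, the hyperbolic sine of it within one
  sheet.\<close>

definition edge_sin :: "real \<Rightarrow> real^4 \<Rightarrow> real^4 \<Rightarrow> real" where
  "edge_sin \<sigma> x y = sqrt (\<sigma> * (1 - (ip \<sigma> x y)\<^sup>2))"

lemma edge_sin_pos: "edge \<sigma> x y \<Longrightarrow> edge_sin \<sigma> x y > 0"
  by (simp add: edge_sin_def edge_def)

lemma edge_sin_square: "edge \<sigma> x y \<Longrightarrow> (edge_sin \<sigma> x y)\<^sup>2 = \<sigma> * (1 - (ip \<sigma> x y)\<^sup>2)"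
  by (simp add: edge_sin_def edge_def)

lemma edge_sin_sym: "edge_sin \<sigma> x y = edge_sin \<sigma> y x"
  by (simp add: edge_sin_def ip_commute)

lemma edge_dir_eq:
  assumes "edge \<sigma> x y"
  shows "edge_dir \<sigma> x y = (1 / edge_sin \<sigma> x y) *\<^sub>R (y - (\<sigma> * ip \<sigma> x y) *\<^sub>R x)"
proof -
  have "ip \<sigma> (y - (\<sigma> * ip \<sigma> y x) *\<^sub>R x) (y - (\<sigma> * ip \<sigma> y x) *\<^sub>R x) = \<sigma> * (1 - (ip \<sigma> x y)\<^sup>2)"
    using assms by (auto simp: edge_def model_space_def ip_commute[of \<sigma> y x] power2_eq_square algebra_simps)
  then show ?thesis
    by (simp add: edge_dir_def Let_def edge_sin_def ip_commute[of \<sigma> y x] divide_inverse)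
qed

lemma edge_dir_tangent: "edge \<sigma> x y \<Longrightarrow> edge_dir \<sigma> x y \<in> tangent_space \<sigma> x"
  by (auto simp: edge_dir_eq edge_def tangent_space_def model_space_def ip_commute[of \<sigma> y x])

lemma ip_edge_dir:
  assumes "edge \<sigma> x y" "edge \<sigma> x z"
  shows "ip \<sigma> (edge_dir \<sigma> x y) (edge_dir \<sigma> x z) = (ip \<sigma> y z - \<sigma> * ip \<sigma> x y * ip \<sigma> x z) / (edge_sin \<sigma> x y * edge_sin \<sigma> x z)"
  using assms by (auto simp: edge_dir_eq edge_def model_space_def ip_commute[of \<sigma> y x] algebra_simps add_divide_distrib diff_divide_distrib)

lemma edge_dir_unit: "edge \<sigma> x y \<Longrightarrow> ip \<sigma> (edge_dir \<sigma> x y) (edge_dir \<sigma> x y) = 1"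
  using edge_sin_pos[of \<sigma> x y] edge_sin_square[of \<sigma> x y]
  by (auto simp: ip_edge_dir edge_def model_space_def power2_eq_square field_simps)

lemma edge_ip_sum: "edge \<sigma> x y \<Longrightarrow> ip \<sigma> (x + y) (x + y) = 2 * (\<sigma> + ip \<sigma> x y)"
  by (simp add: edge_def model_space_def ip_commute[of \<sigma> y x])

lemma edge_ip_nonzero:
  assumes "edge \<sigma> x y"
  shows "\<sigma> + ip \<sigma> x y \<noteq> 0"
proof
  assume "\<sigma> + ip \<sigma> x y = 0"
  then have "ip \<sigma> x y = - \<sigma>" by simp
  with assms show False by (auto simp: edge_def)
qed

lemma edge_sum_nonzero: "edge \<sigma> x y \<Longrightarrow> ip \<sigma> (x + y) (x + y) \<noteq> 0"
  by (metis edge_ip_sum edge_ip_nonzero mult_eq_0_iff zero_neq_numeral)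

text \<open>The sum of the two unit velocities is a multiple of \<open>x + y\<close>, so transport is a reflection,
  also across infinity. This makes its isometry and orientation properties immediate.\<close>

lemma transport_eq_mirror:
  assumes e: "edge \<sigma> x y" and v: "v \<in> tangent_space \<sigma> x"
  shows "transport \<sigma> x y v = mirror \<sigma> (x + y) v"
proof -
  define r s where "r = ip \<sigma> x y" and "s = edge_sin \<sigma> x y"
  have s: "s > 0" "s\<^sup>2 = \<sigma> * (1 - r\<^sup>2)" and \<sigma>: "\<sigma> * \<sigma> = 1"
    using edge_sin_pos[OF e] edge_sin_square[OF e] e by (auto simp: s_def r_def edge_def)
  have ne: "\<sigma> + r \<noteq> 0" using edge_ip_nonzero[OF e] by (simp add: r_def)
  have "edge_dir \<sigma> x y + edge_dir \<sigma> y x = ((1 - \<sigma> * r) / s) *\<^sub>R (x + y)"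
    using edge_dir_eq[OF e] edge_dir_eq[OF edge_sym[OF e]]
    by (simp add: edge_sin_sym[of \<sigma> y x] ip_commute[of \<sigma> y x] flip: r_def s_def)
       (simp add: algebra_simps diff_divide_distrib)
  moreover have "ip \<sigma> v (edge_dir \<sigma> x y) = ip \<sigma> v y / s"
    using v edge_dir_eq[OF e] by (simp add: tangent_space_def flip: s_def)
  moreover have "ip \<sigma> v y / s * ((1 - \<sigma> * r) / s) = ip \<sigma> v y / (\<sigma> + r)"
  proof -
    have "(1 - \<sigma> * r) * (\<sigma> + r) = s\<^sup>2"
      unfolding s(2) using \<sigma> by algebra
    then have "(1 - \<sigma> * r) / s\<^sup>2 = 1 / (\<sigma> + r)"
      using ne s(1) by (simp add: frac_eq_eq)
    then show ?thesis
      by (metis mult.right_neutral power2_eq_square times_divide_eq_right times_divide_times_eq)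
  qed
  moreover have "2 * ip \<sigma> v (x + y) / ip \<sigma> (x + y) (x + y) = ip \<sigma> v y / (\<sigma> + r)"
    unfolding edge_ip_sum[OF e] using v by (simp add: tangent_space_def r_def del: distrib_left_numeral)
  ultimately show ?thesis
    by (simp add: transport_def mirror_def)
qed

lemma mirror_edge:
  assumes e: "edge \<sigma> x y"
  shows "mirror \<sigma> (x + y) x = - y"
proof -
  have "2 * ip \<sigma> x (x + y) = ip \<sigma> (x + y) (x + y)"
    using e by (simp add: edge_def model_space_def ip_commute[of \<sigma> y x])
  then show ?thesis
    using edge_sum_nonzero[OF e] by (simp add: mirror_def del: ip_linear)
qed

definition tangent_isometry :: "real \<Rightarrow> real^4 \<Rightarrow> real^4 \<Rightarrow> (real^4 \<Rightarrow> real^4) \<Rightarrow> bool" where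
  "tangent_isometry \<sigma> x y f \<longleftrightarrow> linear f \<and> (\<forall>v\<in>tangent_space \<sigma> x. f v \<in> tangent_space \<sigma> y) \<and>
     (\<forall>v\<in>tangent_space \<sigma> x. \<forall>w\<in>tangent_space \<sigma> x. ip \<sigma> (f v) (f w) = ip \<sigma> v w) \<and>
     (\<forall>u\<in>tangent_space \<sigma> x. \<forall>v\<in>tangent_space \<sigma> x. \<forall>w\<in>tangent_space \<sigma> x. vol (f u) (f v) (f w) y = vol u v w x)"

lemma tangent_isometry_comp:
  "tangent_isometry \<sigma> y z g \<Longrightarrow> tangent_isometry \<sigma> x y f \<Longrightarrow> tangent_isometry \<sigma> x z (g \<circ> f)"
  by (simp add: tangent_isometry_def linear_compose)

lemma transport_isometry:
  assumes e: "edge \<sigma> x y"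
  shows "tangent_isometry \<sigma> x y (transport \<sigma> x y)"
proof -
  note ne = edge_sum_nonzero[OF e]
  have "linear (transport \<sigma> x y)"
    by (rule linearI) (simp_all add: transport_def algebra_simps)
  moreover have "mirror \<sigma> (x + y) v \<in> tangent_space \<sigma> y" if "v \<in> tangent_space \<sigma> x" for v
    using ip_mirror[OF ne, of v x] that by (simp add: mirror_edge[OF e] tangent_space_def)
  moreover have "vol (mirror \<sigma> (x + y) u) (mirror \<sigma> (x + y) v) (mirror \<sigma> (x + y) w) y = vol u v w x" for u v w
    using vol_mirror[OF ne, of u v w x] by (simp add: mirror_edge[OF e])
  ultimately show ?thesis
    by (simp add: tangent_isometry_def transport_eq_mirror[OF e] ip_mirror[OF ne])
qed

lemma transport_tangent: "edge \<sigma> x y \<Longrightarrow> v \<in> tangent_space \<sigma> x \<Longrightarrow> transport \<sigma> x y v \<in> tangent_space \<sigma> y"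
  using transport_isometry by (simp add: tangent_isometry_def)

lemma transport_back:
  assumes "edge \<sigma> x y" "v \<in> tangent_space \<sigma> x"
  shows "transport \<sigma> y x (transport \<sigma> x y v) = v"
  using transport_eq_mirror[OF edge_sym[OF assms(1)] transport_tangent[OF assms]] transport_eq_mirror[OF assms]
    mirror_mirror[OF edge_sum_nonzero[OF assms(1)], of v] by (simp add: add.commute)

lemma transport_fix:
  "edge \<sigma> x y \<Longrightarrow> ip \<sigma> v x = 0 \<Longrightarrow> ip \<sigma> v y = 0 \<Longrightarrow> transport \<sigma> x y v = v"
  by (simp add: transport_eq_mirror tangent_space_def mirror_def)

lemma transport_edge_dir: "edge \<sigma> x y \<Longrightarrow> transport \<sigma> x y (edge_dir \<sigma> x y) = - edge_dir \<sigma> y x"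
  by (simp add: transport_def edge_dir_unit)

text \<open>Frames carried along edges let velocities at different vertices be compared inside one
  copy of \<open>real^3\<close>.\<close>

lemma frame_transport:
  assumes e: "edge \<sigma> x y" and F: "oriented_frame \<sigma> x F"
  shows "oriented_frame \<sigma> y (F \<circ> mirror \<sigma> (x + y))"
  using frame_mirror[OF _ _ _ edge_sum_nonzero[OF e] F] e by (simp add: edge_def)

section \<open>Corner angles and the holonomy of a single triangle\<close>

lemma vol_edge_dir_pos:
  assumes "edge \<sigma> x y" "edge \<sigma> x z" "vol N y z x > 0"
  shows "vol N (edge_dir \<sigma> x y) (edge_dir \<sigma> x z) x > 0"
  using assms edge_sin_pos[OF assms(1)] edge_sin_pos[OF assms(2)] by (simp add: edge_dir_eq)

lemma frame_norm: "oriented_frame \<sigma> x F \<Longrightarrow> v \<in> tangent_space \<sigma> x \<Longrightarrow> ip \<sigma> v v = 1 \<Longrightarrow> norm (F v) = 1"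
  by (simp add: norm_eq_1 frame_inner)

lemma ip_edge_dir_zero: "edge \<sigma> x y \<Longrightarrow> ip \<sigma> N x = 0 \<Longrightarrow> ip \<sigma> N y = 0 \<Longrightarrow> ip \<sigma> N (edge_dir \<sigma> x y) = 0"
  by (simp add: edge_dir_eq)

text \<open>In a frame the corner is a pair of unit vectors orthogonal to the face normal; the
  orientation of the face makes its angle counterclockwise and strictly between 0 and pi. The cosine
  formula feeds the dual cosine rule.\<close>

lemma corner_angle_frame:
  assumes xy: "edge \<sigma> x y" and xz: "edge \<sigma> x z" and F: "oriented_frame \<sigma> x F"
    and N: "ip \<sigma> N x = 0" "ip \<sigma> N y = 0" "ip \<sigma> N z = 0" "ip \<sigma> N N = 1" and pos: "vol N y z x > 0"
  defines "e \<equiv> F (edge_dir \<sigma> x y)" and "f \<equiv> F (edge_dir \<sigma> x z)"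
  shows "F N \<bullet> e = 0" "F N \<bullet> f = 0" "norm e = 1" "norm f = 1" "F N \<bullet> cross3 e f > 0"
    "corner_angle \<sigma> x y z = arccos (e \<bullet> f)" "0 < corner_angle \<sigma> x y z" "corner_angle \<sigma> x y z < pi"
    "cos (corner_angle \<sigma> x y z) = (ip \<sigma> y z - \<sigma> * ip \<sigma> x y * ip \<sigma> x z) / (edge_sin \<sigma> x y * edge_sin \<sigma> x z)"
proof -
  have \<sigma>: "\<sigma> = 1 \<or> \<sigma> = -1" and x: "x \<in> model_space \<sigma>" using xy by (simp_all add: edge_def)
  have t: "N \<in> tangent_space \<sigma> x" "edge_dir \<sigma> x y \<in> tangent_space \<sigma> x" "edge_dir \<sigma> x z \<in> tangent_space \<sigma> x"
    using N(1) edge_dir_tangent xy xz by (simp_all add: tangent_space_def)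
  show a: "F N \<bullet> e = 0" "F N \<bullet> f = 0" "norm e = 1" "norm f = 1"
    unfolding e_def f_def using t N xy xz
    by (simp_all add: frame_inner[OF F] frame_norm[OF F] ip_edge_dir_zero edge_dir_unit)
  show b: "F N \<bullet> cross3 e f > 0"
    unfolding e_def f_def using vol_edge_dir_pos[OF xy xz pos] by (simp add: frame_vol[OF \<sigma> x F] t)
  show c: "corner_angle \<sigma> x y z = arccos (e \<bullet> f)"
    unfolding e_def f_def corner_angle_def using t by (simp add: frame_inner[OF F])
  have "norm (F N) = 1" using t N by (simp add: frame_norm[OF F])
  then show "0 < corner_angle \<sigma> x y z" "corner_angle \<sigma> x y z < pi"
    using turn_arccos[OF _ a(3,4,1,2) b] by (simp_all add: c)
  have "\<bar>e \<bullet> f\<bar> \<le> 1" using Cauchy_Schwarz_ineq2[of e f] a(3,4) by simp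
  then have "cos (corner_angle \<sigma> x y z) = e \<bullet> f" by (simp add: c abs_le_iff cos_arccos)
  then show "cos (corner_angle \<sigma> x y z) = (ip \<sigma> y z - \<sigma> * ip \<sigma> x y * ip \<sigma> x z) / (edge_sin \<sigma> x y * edge_sin \<sigma> x z)"
    using t by (simp add: e_def f_def frame_inner[OF F] ip_edge_dir[OF xy xz])
qed

text \<open>Frames at \<open>B\<close> and \<open>C\<close> are carried from \<open>A\<close>, so
  the sides \<open>AB\<close> and \<open>AC\<close> have opposite velocities at their two ends. Only
  the side \<open>BC\<close> is not straightened in this way; it supplies the hypothesis
  \<open>P *v b = - c\<close> of \<open>turn_triangle\<close>.\<close>

lemma triangle_holonomy:
  assumes AB: "edge \<sigma> A B" and BC: "edge \<sigma> B C" and CA: "edge \<sigma> C A" and F: "oriented_frame \<sigma> A F"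
    and N: "ip \<sigma> N A = 0" "ip \<sigma> N B = 0" "ip \<sigma> N C = 0" "ip \<sigma> N N = 1" and pos: "vol N B C A > 0"
    and P: "rotation_matrix P"
    and hol: "\<And>v. v \<in> tangent_space \<sigma> A \<Longrightarrow> P *v F v = F (transport \<sigma> C A (transport \<sigma> B C (transport \<sigma> A B v)))"
  shows "P = rodrigues (F N) (corner_angle \<sigma> A B C + corner_angle \<sigma> B C A + corner_angle \<sigma> C A B - pi)"
proof -
  let ?FB = "F \<circ> mirror \<sigma> (A + B)" and ?FC = "F \<circ> mirror \<sigma> (A + C)"
  note BA = edge_sym[OF AB] and CB = edge_sym[OF BC] and AC = edge_sym[OF CA]
  have FB: "oriented_frame \<sigma> B ?FB" and FC: "oriented_frame \<sigma> C ?FC"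
    using frame_transport F AB AC by blast+
  have linF: "F (- v) = - F v" for v
    using frame_linear[OF F] by (rule linear_neg)
  have pos': "vol N C A B > 0" "vol N A B C > 0"
    using pos vol_swap(2,3)[of N C A B] vol_swap(2,3)[of N A B C] vol_swap[of N C B A] vol_swap[of N B A C] by linarith+
  have NB: "?FB N = F N" and NC: "?FC N = F N"
    using N by (simp_all add: mirror_fix)
  define a1 a2 b c where "a1 = F (edge_dir \<sigma> A B)" and "a2 = F (edge_dir \<sigma> A C)"
    and "b = ?FB (edge_dir \<sigma> B C)" and "c = ?FC (edge_dir \<sigma> C B)"
  have a1': "?FB (edge_dir \<sigma> B A) = - a1"
    using transport_edge_dir[OF BA] transport_eq_mirror[OF BA edge_dir_tangent[OF BA]]
    by (simp add: a1_def add.commute linF)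
  have a2': "?FC (edge_dir \<sigma> C A) = - a2"
    using transport_edge_dir[OF CA] transport_eq_mirror[OF CA edge_dir_tangent[OF CA]]
    by (simp add: a2_def add.commute linF)
  note A = corner_angle_frame[OF AB AC F N(1,2,3,4) pos, folded a1_def a2_def]
  note B = corner_angle_frame[OF BC BA FB N(2,3,1,4) pos'(1), unfolded NB a1', folded b_def]
  note C = corner_angle_frame[OF CA CB FC N(3,1,2,4) pos'(2), unfolded NC a2', folded c_def]
  have tN: "N \<in> tangent_space \<sigma> A" using N by (simp add: tangent_space_def)
  have "P *v F N = F N"
    using N by (simp add: hol[OF tN] transport_fix AB BC CA)
  moreover have "P *v b = - c"
  proof -
    \<comment> \<open>Starting the loop with this vector cancels its first leg, so that the second
      leg acts on the direction of its own edge.\<close>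
    let ?w = "transport \<sigma> B A (edge_dir \<sigma> B C)"
    have w: "?w \<in> tangent_space \<sigma> A"
      by (rule transport_tangent[OF BA edge_dir_tangent[OF BC]])
    have "transport \<sigma> A B ?w = edge_dir \<sigma> B C"
      by (rule transport_back[OF BA edge_dir_tangent[OF BC]])
    then have "P *v F ?w = F (transport \<sigma> C A (- edge_dir \<sigma> C B))"
      by (simp add: hol[OF w] transport_edge_dir[OF BC])
    also have "transport \<sigma> C A (- edge_dir \<sigma> C B) = - mirror \<sigma> (A + C) (edge_dir \<sigma> C B)"
      using transport_isometry[OF CA] linear_neg transport_eq_mirror[OF CA edge_dir_tangent[OF CB]]
      by (metis add.commute tangent_isometry_def)
    finally show ?thesis
      using transport_eq_mirror[OF BA edge_dir_tangent[OF BC]] by (simp add: b_def c_def linF add.commute)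
  qed
  moreover have "norm (F N) = 1"
    using frame_norm[OF F tN N(4)] .
  ultimately show ?thesis
    using turn_triangle[of "F N" P b c a1 a2] P A B C by simp
qed

section \<open>Angle sums\<close>

text \<open>\<open>p\<close>, \<open>q\<close>, \<open>r\<close> are the inner products of the
  vertices and \<open>P\<close>, \<open>Q\<close>, \<open>R\<close> the edge sines, each opposite to
  the angle of the same letter. \<open>\<sigma> * p\<close> plays the part of the cosine or
  hyperbolic cosine of a side, and is negative for a side through infinity.\<close>

lemma dual_cosine_rule:
  fixes a b c p q r P Q R \<sigma> :: real
  assumes \<sigma>: "\<sigma> * \<sigma> = 1" and pos: "P > 0" "Q > 0" "R > 0"
    and sq: "P\<^sup>2 = \<sigma> * (1 - p\<^sup>2)" "Q\<^sup>2 = \<sigma> * (1 - q\<^sup>2)" "R\<^sup>2 = \<sigma> * (1 - r\<^sup>2)"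
    and b: "0 < b" "b < pi" and c: "0 < c" "c < pi"
    and cos: "cos a = (p - \<sigma> * r * q) / (R * Q)" "cos b = (q - \<sigma> * p * r) / (P * R)" "cos c = (r - \<sigma> * q * p) / (Q * P)"
  shows "cos a + cos b * cos c = \<sigma> * p * (sin b * sin c)"
proof -
  \<comment> \<open>\<open>\<sigma>\<close> times the Gram determinant of the vertices. Its symmetry
    gives the law of sines in the form that both angle sines, times their edge sines, equal
    \<open>sqrt D\<close>.\<close>
  define D where "D = 1 - p\<^sup>2 - q\<^sup>2 - r\<^sup>2 + 2 * \<sigma> * p * q * r"
  have cos': "cos b * (P * R) = q - \<sigma> * p * r" "cos c * (Q * P) = r - \<sigma> * q * p" "cos a * (R * Q) = p - \<sigma> * r * q"
    using pos cos by simp_all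
  have "(sin b * (P * R))\<^sup>2 = P\<^sup>2 * R\<^sup>2 - (cos b * (P * R))\<^sup>2" "(sin c * (Q * P))\<^sup>2 = P\<^sup>2 * Q\<^sup>2 - (cos c * (Q * P))\<^sup>2"
    by (simp_all add: power_mult_distrib sin_squared_eq algebra_simps)
  then have "(sin b * (P * R))\<^sup>2 = D" "(sin c * (Q * P))\<^sup>2 = D"
    unfolding cos' sq D_def using \<sigma> by algebra+
  moreover have "sin b * (P * R) > 0" "sin c * (Q * P) > 0"
    using pos sin_gt_zero b c by simp_all
  ultimately have "sin b * (P * R) = sqrt D" "sin c * (Q * P) = sqrt D" "D \<ge> 0"
    by (metis less_le real_sqrt_unique, metis less_le real_sqrt_unique, metis zero_le_power2)
  then have D: "sin b * sin c * (R * Q * P\<^sup>2) = D"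
    by (metis (no_types, opaque_lifting) mult.assoc mult.commute mult.left_commute power2_eq_square real_sqrt_mult_self abs_of_nonneg)
  have "(cos a + cos b * cos c) * (R * Q * P\<^sup>2) = (cos a * (R * Q)) * P\<^sup>2 + (cos b * (P * R)) * (cos c * (Q * P))"
    by (simp add: algebra_simps power2_eq_square)
  also have "\<dots> = \<sigma> * p * D"
    unfolding cos' sq D_def using \<sigma> by algebra
  also have "\<dots> = \<sigma> * p * (sin b * sin c) * (R * Q * P\<^sup>2)"
    by (simp add: D[symmetric])
  finally show ?thesis
    using pos by simp
qed

text \<open>The inequality compares \<open>cos a\<close> with \<open>cos (pi - b - c)\<close>, and
  the cosine decreases on the range in question.\<close>

lemma angle_sum_gt_pi:
  fixes a b c :: real
  assumes a: "0 < a" "a < pi" and b: "0 < b" "b < pi" and c: "0 < c" "c < pi"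
    and less: "cos a + cos b * cos c < sin b * sin c"
  shows "a + b + c > pi"
proof (rule ccontr)
  assume "\<not> ?thesis"
  then have "cos (pi - b - c) \<le> cos a"
    using a b c by (intro cos_monotone_0_pi_le) auto
  moreover have "cos (pi - b - c) = - cos (b + c)"
    using cos_minus_pi[of "b + c"] cos_minus[of "b + c - pi"] by (simp add: algebra_simps)
  ultimately show False
    using less by (simp add: cos_add)
qed

text \<open>Each inequality yields only \<open>x < \<bar>y + z - pi\<bar>\<close>. The unwanted case
  \<open>x < y + z - pi\<close> contradicts the good case for another angle, and two unwanted cases
  add up to an angle above pi.\<close>

lemma angle_sum_less_pi:
  fixes a b c :: real
  assumes a: "0 < a" "a < pi" and b: "0 < b" "b < pi" and c: "0 < c" "c < pi"
    and gr: "cos a + cos b * cos c > sin b * sin c" "cos b + cos c * cos a > sin c * sin a" "cos c + cos a * cos b > sin a * sin b"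
  shows "a + b + c < pi"
proof -
  have key: "x < \<bar>y + z - pi\<bar>" if "0 < x" "x < pi" "0 < y" "y < pi" "0 < z" "z < pi" "cos x + cos y * cos z > sin y * sin z" for x y z
  proof (rule ccontr)
    assume "\<not> ?thesis"
    then have "cos x \<le> cos \<bar>y + z - pi\<bar>"
      using that by (intro cos_monotone_0_pi_le) auto
    also have "\<dots> = - cos (y + z)" by (simp add: cos_diff)
    finally show False using that by (simp add: cos_add)
  qed
  show ?thesis
    using key[OF a b c gr(1)] key[OF b c a gr(2)] key[OF c a b gr(3)] a b c by linarith
qed

text \<open>Reversed Cauchy-Schwarz inequality: the first coordinates outweigh the spatial product,
  by Lagrange's identity, and so decide the sign of \<open>ip\<close>.\<close>

lemma same_sheet_iff:
  assumes x: "x \<in> model_space (-1)" and y: "y \<in> model_space (-1)"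
  shows "x $ 1 * y $ 1 > 0 \<longleftrightarrow> ip (-1) x y < 0" "x $ 1 \<noteq> 0"
proof -
  define d where "d = x$2 * y$2 + x$3 * y$3 + x$4 * y$4"
  have sq: "(x$1)\<^sup>2 = 1 + (x$2)\<^sup>2 + (x$3)\<^sup>2 + (x$4)\<^sup>2" "(y$1)\<^sup>2 = 1 + (y$2)\<^sup>2 + (y$3)\<^sup>2 + (y$4)\<^sup>2"
    using x y by (simp_all add: model_space_def ip_expand power2_eq_square)
  have "(x$1 * y$1)\<^sup>2 = d\<^sup>2 + 1 + (x$2)\<^sup>2 + (x$3)\<^sup>2 + (x$4)\<^sup>2 + (y$2)\<^sup>2 + (y$3)\<^sup>2 + (y$4)\<^sup>2
      + (x$2 * y$3 - x$3 * y$2)\<^sup>2 + (x$2 * y$4 - x$4 * y$2)\<^sup>2 + (x$3 * y$4 - x$4 * y$3)\<^sup>2"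
    unfolding power_mult_distrib sq d_def by algebra
  then have "d\<^sup>2 < (x$1 * y$1)\<^sup>2"
    by (smt (verit) zero_le_power2)
  then have "\<bar>d\<bar> < \<bar>x$1 * y$1\<bar>"
    using power_less_imp_less_base[of "\<bar>d\<bar>" 2 "\<bar>x$1 * y$1\<bar>"] by simp
  then show "x $ 1 * y $ 1 > 0 \<longleftrightarrow> ip (-1) x y < 0"
    by (simp add: ip_expand d_def) linarith
  show "x $ 1 \<noteq> 0"
    using sq(1) by (smt (verit) zero_le_power2 zero_eq_power2)
qed

text \<open>\<open>\<sigma> * ip\<close> of a side is below 1 on the sphere, above 1 within one
  sheet and below -1 through infinity. By the dual cosine rule one side below 1 puts the angle sum
  above pi, and three sides above 1 put it below pi.\<close>

lemma triangle_area_holonomy: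
  assumes AB: "edge \<sigma> A B" and BC: "edge \<sigma> B C" and CA: "edge \<sigma> C A" and F: "oriented_frame \<sigma> A F"
    and N: "ip \<sigma> N A = 0" "ip \<sigma> N B = 0" "ip \<sigma> N C = 0" "ip \<sigma> N N = 1" and pos: "vol N B C A > 0"
  shows "0 < triangle_area \<sigma> A B C" "triangle_area \<sigma> A B C < 2 * pi"
    "rodrigues (F N) (corner_angle \<sigma> A B C + corner_angle \<sigma> B C A + corner_angle \<sigma> C A B - pi)
      = matrix_exp ((\<sigma> * triangle_area \<sigma> A B C) *\<^sub>R so3_generator (F N))"
proof -
  let ?FB = "F \<circ> mirror \<sigma> (A + B)" and ?FC = "F \<circ> mirror \<sigma> (A + C)"
  let ?a = "corner_angle \<sigma> A B C" and ?b = "corner_angle \<sigma> B C A" and ?c = "corner_angle \<sigma> C A B"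
  let ?p = "ip \<sigma> B C" and ?q = "ip \<sigma> C A" and ?r = "ip \<sigma> A B"
  note BA = edge_sym[OF AB] and CB = edge_sym[OF BC] and AC = edge_sym[OF CA]
  have FB: "oriented_frame \<sigma> B ?FB" and FC: "oriented_frame \<sigma> C ?FC"
    using frame_transport F AB AC by blast+
  have pos': "vol N C A B > 0" "vol N A B C > 0"
    using pos vol_swap(2,3)[of N C A B] vol_swap(2,3)[of N A B C] vol_swap[of N C B A] vol_swap[of N B A C] by linarith+
  note a = corner_angle_frame(7-9)[OF AB AC F N(1,2,3,4) pos, unfolded ip_commute[of \<sigma> A C] edge_sin_sym[of \<sigma> A C]]
    and b = corner_angle_frame(7-9)[OF BC BA FB N(2,3,1,4) pos'(1), unfolded ip_commute[of \<sigma> B A] edge_sin_sym[of \<sigma> B A]]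
    and c = corner_angle_frame(7-9)[OF CA CB FC N(3,1,2,4) pos'(2), unfolded ip_commute[of \<sigma> C B] edge_sin_sym[of \<sigma> C B]]
  have \<sigma>: "\<sigma> = 1 \<or> \<sigma> = -1" and M: "A \<in> model_space \<sigma>" "B \<in> model_space \<sigma>" "C \<in> model_space \<sigma>"
    using AB BC by (simp_all add: edge_def)
  have \<sigma>\<sigma>: "\<sigma> * \<sigma> = 1" using \<sigma> by auto
  note s = edge_sin_pos[OF AB] edge_sin_pos[OF BC] edge_sin_pos[OF CA]
    edge_sin_square[OF AB] edge_sin_square[OF BC] edge_sin_square[OF CA]
  have ra: "cos ?a + cos ?b * cos ?c = \<sigma> * ?p * (sin ?b * sin ?c)"
    using dual_cosine_rule[OF \<sigma>\<sigma> s(2,3,1) s(5,6,4) b(1,2) c(1,2)] a(3) b(3) c(3) by (simp add: ip_commute ac_simps)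
  have rb: "cos ?b + cos ?c * cos ?a = \<sigma> * ?q * (sin ?c * sin ?a)"
    using dual_cosine_rule[OF \<sigma>\<sigma> s(3,1,2) s(6,4,5) c(1,2) a(1,2)] a(3) b(3) c(3) by (simp add: ip_commute ac_simps)
  have rc: "cos ?c + cos ?a * cos ?b = \<sigma> * ?r * (sin ?a * sin ?b)"
    using dual_cosine_rule[OF \<sigma>\<sigma> s(1,2,3) s(4,5,6) a(1,2) b(1,2)] a(3) b(3) c(3) by (simp add: ip_commute ac_simps)
  have sin: "sin ?a > 0" "sin ?b > 0" "sin ?c > 0"
    using a b c by (simp_all add: sin_gt_zero)
  have gt: "?a + ?b + ?c > pi" if "\<sigma> * ?p < 1 \<or> \<sigma> * ?q < 1 \<or> \<sigma> * ?r < 1"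
  proof -
    from that consider "\<sigma> * ?p < 1" | "\<sigma> * ?q < 1" | "\<sigma> * ?r < 1" by blast
    then show ?thesis
    proof cases
      case 1
      then have "\<sigma> * ?p * (sin ?b * sin ?c) < sin ?b * sin ?c" using sin by simp
      then show ?thesis using angle_sum_gt_pi[of ?a ?b ?c] a b c ra by simp
    next
      case 2
      then have "\<sigma> * ?q * (sin ?c * sin ?a) < sin ?c * sin ?a" using sin by simp
      then show ?thesis using angle_sum_gt_pi[of ?b ?c ?a] a b c rb by simp
    next
      case 3
      then have "\<sigma> * ?r * (sin ?a * sin ?b) < sin ?a * sin ?b" using sin by simp
      then show ?thesis using angle_sum_gt_pi[of ?c ?a ?b] a b c rc by simp
    qed
  qed
  have less: "?a + ?b + ?c < pi" if "\<sigma> * ?p > 1" "\<sigma> * ?q > 1" "\<sigma> * ?r > 1"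
    using that angle_sum_less_pi[of ?a ?b ?c] a b c ra rb rc sin by simp
  have n: "norm (F N) = 1"
    using frame_norm[OF F] N by (simp add: tangent_space_def)
  let ?s = "?a + ?b + ?c"
  \<comment> \<open>The second alternative is the two-sheeted one: \<open>?s - pi\<close> then
    exceeds \<open>\<sigma>\<close> times the area by a full turn, which \<open>rodrigues\<close>
    does not see.\<close>
  have area: "0 < triangle_area \<sigma> A B C \<and> triangle_area \<sigma> A B C < 2 * pi
     \<and> (?s - pi = \<sigma> * triangle_area \<sigma> A B C \<or> ?s - pi = \<sigma> * triangle_area \<sigma> A B C + 2 * pi)"
  proof (cases "\<sigma> = 1")
    case True
    have "?p\<^sup>2 < 1" using BC by (simp add: edge_def True)
    then have "\<sigma> * ?p < 1" using abs_square_less_1[of ?p] by (simp add: True)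
    with gt have "?s > pi" by blast
    then show ?thesis
      using a b c by (simp add: triangle_area_def Let_def True)
  next
    case False
    with \<sigma> have \<sigma>: "\<sigma> = -1" by simp
    have big: "\<bar>?p\<bar> > 1" "\<bar>?q\<bar> > 1" "\<bar>?r\<bar> > 1"
      using AB BC CA by (simp_all add: edge_def \<sigma> abs_square_le_1 flip: linorder_not_le)
    show ?thesis
    proof (cases "one_sheeted {A, B, C}")
      case True
      then have "?p < 0" "?q < 0" "?r < 0"
        using M unfolding \<sigma> by (auto simp: one_sheeted_def same_sheet_iff(1)[symmetric] intro: mult_neg_neg)
      with big have "?s < pi" by (intro less) (auto simp: \<sigma>)
      then show ?thesis
        using True a b c by (simp add: triangle_area_def Let_def \<sigma>)
    next
      case False
      have "\<not> (?p < 0 \<and> ?q < 0 \<and> ?r < 0)"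
      proof
        assume "?p < 0 \<and> ?q < 0 \<and> ?r < 0"
        then have "A$1 * B$1 > 0" "B$1 * C$1 > 0"
          using M unfolding \<sigma> by (simp_all add: same_sheet_iff(1))
        with False show False
          by (auto simp: one_sheeted_def zero_less_mult_iff)
      qed
      with big have "\<sigma> * ?p < 1 \<or> \<sigma> * ?q < 1 \<or> \<sigma> * ?r < 1" by (auto simp: \<sigma>)
      with gt have "?s > pi" by blast
      then show ?thesis
        using False a b c by (simp add: triangle_area_def Let_def \<sigma>)
    qed
  qed
  then show "0 < triangle_area \<sigma> A B C" "triangle_area \<sigma> A B C < 2 * pi" by simp_all
  from area show "rodrigues (F N) (?s - pi) = matrix_exp ((\<sigma> * triangle_area \<sigma> A B C) *\<^sub>R so3_generator (F N))"
    by (metis matrix_exp_generator[OF n] rodrigues_add_2pi)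
qed

lemma corner_angle_sym: "corner_angle \<sigma> x y z = corner_angle \<sigma> x z y"
  by (simp add: corner_angle_def ip_commute)

lemma triangle_area_perm: "triangle_area \<sigma> x y z = triangle_area \<sigma> y z x" "triangle_area \<sigma> x y z = triangle_area \<sigma> x z y"
  unfolding triangle_area_def Let_def corner_angle_sym[of \<sigma> x z] corner_angle_sym[of \<sigma> z y] corner_angle_sym[of \<sigma> y x]
  by (simp_all add: insert_commute ac_simps)

section \<open>Tetrahedra and their holonomies\<close>

lemma frame_triple:
  assumes "\<sigma> = 1 \<or> \<sigma> = -1" "x \<in> model_space \<sigma>" "oriented_frame \<sigma> x F"
    "u \<in> tangent_space \<sigma> x" "v \<in> tangent_space \<sigma> x" "w \<in> tangent_space \<sigma> x"
  shows "cross3 (F u) (F v) \<bullet> F w = vol u v w x"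
  using frame_vol[OF assms] cross_triple[of "F u" "F v" "F w"] by (simp add: inner_commute)

lemma rotation_matrixI:
  fixes A :: "real^3^3"
  assumes ip: "\<And>a b. (A *v a) \<bullet> (A *v b) = a \<bullet> b"
    and tr: "\<And>a b c. (A *v a) \<bullet> cross3 (A *v b) (A *v c) = a \<bullet> cross3 b c"
  shows "rotation_matrix A"
proof -
  have "orthogonal_transformation ((*v) A)"
    unfolding orthogonal_transformation_def using ip by simp
  then have o: "orthogonal_matrix A"
    by (simp add: orthogonal_transformation_matrix)
  let ?a = "axis 1 1 :: real^3" and ?b = "axis 2 1 :: real^3" and ?c = "axis 3 1 :: real^3"
  have "det A * (?a \<bullet> cross3 ?b ?c) = ?a \<bullet> cross3 ?b ?c"
    using tr[of ?a ?b ?c] unfolding cross_orthogonal_matrix[OF o] by (simp add: ip)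
  moreover have "?a \<bullet> cross3 ?b ?c = 1"
    by (simp add: cross_basis inner_axis_axis)
  ultimately show ?thesis
    using o by (simp add: rotation_matrix_def)
qed

text \<open>\<open>vol_neg\<close> encodes both the path orientation and the independence of the
  vertices; injectivity and independence are recovered in \<open>curved_tetrahedron\<close>.\<close>

locale framed_tetrahedron =
  fixes \<sigma> :: real and V :: "4 \<Rightarrow> real^4" and F :: "real^4 \<Rightarrow> real^3"
  assumes curvature: "\<sigma> = 1 \<or> \<sigma> = -1"
    and vertex: "\<And>l. V l \<in> model_space \<sigma>"
    and vol_neg: "vol (V 1) (V 2) (V 3) (V 4) < 0"
    and frame: "oriented_frame \<sigma> (V 4) F"
begin

abbreviation N :: "4 \<Rightarrow> real^4" where "N \<equiv> outward_normal \<sigma> V"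
abbreviation t :: "4 \<Rightarrow> 4 \<Rightarrow> real^4 \<Rightarrow> real^4" where "t \<equiv> edge_transport \<sigma> V"
abbreviation T :: "4 \<Rightarrow> (real^4) set" where "T l \<equiv> tangent_space \<sigma> (V l)"

lemma edges: assumes "l \<noteq> m" shows "edge \<sigma> (V l) (V m)"
proof (rule edgeI[OF curvature vertex vertex])
  fix c
  show "V m \<noteq> c *\<^sub>R V l"
  proof
    assume "V m = c *\<^sub>R V l"
    with vol_neg assms show False
      using exhaust_4[of l] exhaust_4[of m] by auto
  qed
qed

lemma vertices_span:
  assumes "\<And>m. ip \<sigma> v (V m) = 0"
  shows "v = 0"
  using vol_nonzero_imp_zero[of \<sigma> "V 1" "V 2" "V 3" "V 4" v] assms curvature vol_neg by auto

text \<open>A vector orthogonal to a face is tangent at any vertex of the face, hence of positive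
  square also for \<open>\<sigma> = -1\<close>, and can be normalized.\<close>

lemma outward_normal_ex1:
  "\<exists>!n. ip \<sigma> n n = 1 \<and> (\<forall>m. m \<noteq> l \<longrightarrow> ip \<sigma> n (V m) = 0) \<and> ip \<sigma> n (V l) < 0"
proof -
  have "\<exists>u. u \<noteq> 0 \<and> (\<forall>m. m \<noteq> l \<longrightarrow> ip \<sigma> u (V m) = 0)"
    using exhaust_4[of l] exists_orthogonal[OF curvature, of "V 2" "V 3" "V 4"]
      exists_orthogonal[OF curvature, of "V 1" "V 3" "V 4"] exists_orthogonal[OF curvature, of "V 1" "V 2" "V 4"]
      exists_orthogonal[OF curvature, of "V 1" "V 2" "V 3"]
    unfolding forall_4 by (elim disjE) (simp_all, metis+)
  then obtain u where u: "u \<noteq> 0" "\<And>m. m \<noteq> l \<Longrightarrow> ip \<sigma> u (V m) = 0"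
    by blast
  obtain m where "m \<noteq> l" by (metis zero_neq_one)
  then have pos: "ip \<sigma> u u > 0"
    using tangent_space_pos[OF curvature vertex, of u m] u by (simp add: tangent_space_def)
  have ne: "ip \<sigma> u (V l) \<noteq> 0"
    using vertices_span[of u] u by metis
  define k where "k = - sgn (ip \<sigma> u (V l)) / sqrt (ip \<sigma> u u)"
  have k: "k\<^sup>2 * ip \<sigma> u u = 1" "k * ip \<sigma> u (V l) < 0"
    using pos ne by (auto simp: k_def power_divide sgn_if divide_simps)
  show ?thesis
  proof (rule ex1I[of _ "k *\<^sub>R u"])
    show "ip \<sigma> (k *\<^sub>R u) (k *\<^sub>R u) = 1 \<and> (\<forall>m. m \<noteq> l \<longrightarrow> ip \<sigma> (k *\<^sub>R u) (V m) = 0) \<and> ip \<sigma> (k *\<^sub>R u) (V l) < 0"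
      using k u by (simp add: power2_eq_square mult.assoc)
  next
    fix n assume n: "ip \<sigma> n n = 1 \<and> (\<forall>m. m \<noteq> l \<longrightarrow> ip \<sigma> n (V m) = 0) \<and> ip \<sigma> n (V l) < 0"
    define a b where "a = ip \<sigma> n (V l)" and "b = k * ip \<sigma> u (V l)"
    have "b *\<^sub>R n - (a * k) *\<^sub>R u = 0"
    proof (rule vertices_span)
      fix m show "ip \<sigma> (b *\<^sub>R n - (a * k) *\<^sub>R u) (V m) = 0"
        by (cases "m = l") (use n u in \<open>simp_all add: a_def b_def\<close>)
    qed
    then have eq: "b *\<^sub>R n = a *\<^sub>R (k *\<^sub>R u)" by simp
    have "b\<^sup>2 * ip \<sigma> n n = a\<^sup>2 * (k\<^sup>2 * ip \<sigma> u u)"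
      using arg_cong[OF eq, of "\<lambda>z. ip \<sigma> z z"] by (simp add: power2_eq_square ac_simps)
    then have "b\<^sup>2 = a\<^sup>2"
      using n k(1) by simp
    with n k(2) have "a = b" "b \<noteq> 0"
      by (auto simp: a_def b_def power2_eq_iff)
    with eq show "n = k *\<^sub>R u"
      by (metis scaleR_cancel_left)
  qed
qed

lemma normal: "ip \<sigma> (N l) (N l) = 1" "m \<noteq> l \<Longrightarrow> ip \<sigma> (N l) (V m) = 0" "ip \<sigma> (N l) (V l) < 0"
  using theI'[OF outward_normal_ex1[of l], folded outward_normal_def] by auto

lemma normal_orthogonal: "l \<noteq> m \<Longrightarrow> ip \<sigma> (N l) (V m) = 0"
  using normal(2) by metis

lemma normal_eqI:
  "ip \<sigma> n n = 1 \<Longrightarrow> (\<And>m. m \<noteq> l \<Longrightarrow> ip \<sigma> n (V m) = 0) \<Longrightarrow> ip \<sigma> n (V l) < 0 \<Longrightarrow> N l = n"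
  using the1_equality[OF outward_normal_ex1[of l], folded outward_normal_def] by blast

text \<open>Replacing \<open>V a\<close> by \<open>N a\<close> divides the volume by
  \<open>ip \<sigma> (V a) (N a)\<close>, which is negative.\<close>

lemma normal_face_vol:
  assumes "vol (V a) (V b) (V c) (V d) < 0" "b \<noteq> a" "c \<noteq> a" "d \<noteq> a"
  shows "vol (N a) (V b) (V c) (V d) > 0"
proof -
  have "ip \<sigma> (V a) (N a) * vol (N a) (V b) (V c) (V d) = vol (V a) (V b) (V c) (V d)"
    using ip_cramer[of \<sigma> "V a" "N a" "N a" "V b" "V c" "V d"] assms(2-4) normal(1)
    by (simp add: ip_commute[of \<sigma> "V _"] normal(2))
  then show ?thesis
    using assms(1) normal(3)[of a] mult_nonpos_nonpos[of "ip \<sigma> (V a) (N a)" "vol (N a) (V b) (V c) (V d)"]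
    by (simp add: ip_commute[of \<sigma> "V a"]) (metis linorder_not_le)
qed

text \<open>The products of these four vectors with the vertices form a triangular matrix with
  diagonal consisting of three negative numbers and \<open>\<sigma>\<close>.\<close>

lemma normals_vol:
  assumes "vol (V a) (V b) (V c) (V d) < 0" "distinct [a, b, c, d]"
  shows "vol (N a) (N b) (N c) (V d) > 0"
proof -
  have "ip \<sigma> (V d) (V d) = \<sigma>" using vertex by (simp add: model_space_def)
  then have "\<sigma> * (vol (N a) (N b) (N c) (V d) * vol (V a) (V b) (V c) (V d))
      = \<sigma> * (ip \<sigma> (N a) (V a) * (ip \<sigma> (N b) (V b) * ip \<sigma> (N c) (V c)))"
    unfolding vol_mult_vol det_4 vector_nth_4 using assms(2) by (simp add: normal(2) normal_orthogonal)
  then have "vol (N a) (N b) (N c) (V d) * vol (V a) (V b) (V c) (V d)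
      = ip \<sigma> (N a) (V a) * (ip \<sigma> (N b) (V b) * ip \<sigma> (N c) (V c))"
    using curvature by auto
  moreover have "ip \<sigma> (N a) (V a) * (ip \<sigma> (N b) (V b) * ip \<sigma> (N c) (V c)) < 0"
    using normal(3)[of a] normal(3)[of b] normal(3)[of c] by (simp add: mult_neg_neg mult_neg_pos)
  ultimately show ?thesis
    using assms(1) by (metis mult_less_0_iff less_asym)
qed

lemma normal_tangent: "m \<noteq> l \<Longrightarrow> N l \<in> T m"
  by (simp add: tangent_space_def normal)

lemma t_isometry: "l \<noteq> m \<Longrightarrow> tangent_isometry \<sigma> (V l) (V m) (t m l)"
  using transport_isometry[OF edges] by (simp add: edge_transport_def)

lemma t_back: "l \<noteq> m \<Longrightarrow> v \<in> T l \<Longrightarrow> t l m (t m l v) = v"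
  using transport_back[OF edges] by (simp add: edge_transport_def)

lemma t_tangent: "l \<noteq> m \<Longrightarrow> v \<in> T l \<Longrightarrow> t m l v \<in> T m"
  using t_isometry by (simp add: tangent_isometry_def)

lemma t_ip: "l \<noteq> m \<Longrightarrow> v \<in> T l \<Longrightarrow> w \<in> T l \<Longrightarrow> ip \<sigma> (t m l v) (t m l w) = ip \<sigma> v w"
  using t_isometry by (simp add: tangent_isometry_def)

lemma t_vol: "l \<noteq> m \<Longrightarrow> u \<in> T l \<Longrightarrow> v \<in> T l \<Longrightarrow> w \<in> T l \<Longrightarrow> vol (t m l u) (t m l v) (t m l w) (V m) = vol u v w (V l)"
  using t_isometry by (simp add: tangent_isometry_def)

text \<open>The edge lies in face \<open>k\<close>, so both of its ends are orthogonal to the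
  normal.\<close>

lemma t_normal: "distinct [k, l, m] \<Longrightarrow> t m l (N k) = N k"
  using transport_fix[OF edges] normal_orthogonal by (simp add: edge_transport_def)

lemma holonomy_eq:
  "holonomy \<sigma> V 1 = t 4 3 \<circ> t 3 2 \<circ> t 2 4" "holonomy \<sigma> V 2 = t 4 1 \<circ> t 1 3 \<circ> t 3 4"
  "holonomy \<sigma> V 3 = t 4 2 \<circ> t 2 1 \<circ> t 1 4" "holonomy \<sigma> V 4 = t 4 2 \<circ> (t 2 3 \<circ> t 3 1 \<circ> t 1 2) \<circ> t 2 4"
  by (simp_all add: holonomy_def Let_def)

lemma holonomy_isometry: "tangent_isometry \<sigma> (V 4) (V 4) (holonomy \<sigma> V l)"
proof -
  have "\<forall>l. tangent_isometry \<sigma> (V 4) (V 4) (holonomy \<sigma> V l)"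
    unfolding forall_4 holonomy_eq
    by (intro conjI tangent_isometry_comp[OF tangent_isometry_comp[OF t_isometry t_isometry] t_isometry]
        tangent_isometry_comp[OF tangent_isometry_comp[OF t_isometry
          tangent_isometry_comp[OF tangent_isometry_comp[OF t_isometry t_isometry] t_isometry]] t_isometry]) simp_all
  then show ?thesis by blast
qed

lemma holonomy_tangent: "v \<in> T 4 \<Longrightarrow> holonomy \<sigma> V l v \<in> T 4"
  using holonomy_isometry by (simp add: tangent_isometry_def)

lemma curved_tetrahedron: "curved_tetrahedron \<sigma> V"
proof -
  let ?A = "vector [V 1, V 2, V 3, V 4] :: real^4^4"
  have rows: "rows ?A = range V"
  proof -
    have "row i ?A = V i" for i
      using exhaust_4[of i] by (auto simp: row_def)
    then show ?thesis by (auto simp: rows_def)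
  qed
  have "independent (range V)"
    using det_dependent_rows[of ?A] vol_neg
    by (auto simp: rows vol_def dependent_raw_def scalar_mult_eq_scaleR[abs_def])
  moreover have "inj V"
  proof (rule injI, rule ccontr)
    fix l m assume "V l = V m" "l \<noteq> m"
    then show False using edges[of l m] vertex[of m] by (auto simp: edge_def model_space_def)
  qed
  ultimately show ?thesis
    using curvature vertex by (simp add: curved_tetrahedron_def)
qed

lemma realizes_exists: "\<exists>P. realizes \<sigma> V F P"
proof -
  define G where "G = inv_into (T 4) F"
  have bij: "bij_betw F (T 4) UNIV" using frame by (simp add: oriented_frame_def)
  have G: "G a \<in> T 4" "F (G a) = a" for a
    using bij by (auto simp: G_def bij_betw_def inv_into_into f_inv_into_f)
  have linF: "linear F" using frame by (simp add: oriented_frame_def)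
  have "linear G"
  proof (rule linearI)
    show "G (a + b) = G a + G b" for a b
      by (rule frame_inj[OF frame]) (use G(1) in \<open>simp_all add: G linear_add[OF linF] tangent_space_def\<close>)
    show "G (c *\<^sub>R a) = c *\<^sub>R G a" for c a
      by (rule frame_inj[OF frame]) (use G(1) in \<open>simp_all add: G linear_scale[OF linF] tangent_space_def\<close>)
  qed
  then have "linear (F \<circ> holonomy \<sigma> V l \<circ> G)" for l
    using holonomy_isometry[of l] linF by (auto simp: tangent_isometry_def intro!: linear_compose)
  then have "(*v) (matrix (F \<circ> holonomy \<sigma> V l \<circ> G)) = F \<circ> holonomy \<sigma> V l \<circ> G" for l
    by (auto simp: matrix_works)
  then show ?thesis
    using curved_tetrahedron vol_neg frame unfolding realizes_def path_oriented_def vol_def G_def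
    by (intro exI[of _ "\<lambda>l. matrix (F \<circ> holonomy \<sigma> V l \<circ> inv_into (T 4) F)"]) simp
qed

end

lemma realizes_framed:
  assumes "realizes \<sigma> V F P"
  shows "framed_tetrahedron \<sigma> V F"
  using assms by unfold_locales (auto simp: realizes_def curved_tetrahedron_def path_oriented_def vol_def)

locale realization = framed_tetrahedron +
  fixes P
  assumes realizes: "realizes \<sigma> V F P"
begin

definition n :: "4 \<Rightarrow> real^3" where "n l = F (transported_normal \<sigma> V l)"

lemma n_eq: "n 1 = F (N 1)" "n 2 = F (N 2)" "n 3 = F (N 3)" "n 4 = F (t 4 2 (N 4))"
  by (simp_all add: n_def transported_normal_def)

lemma act: assumes v: "v \<in> T 4" shows "P l *v F v = F (holonomy \<sigma> V l v)"
proof -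
  have "inj_on F (T 4)" using frame by (simp add: oriented_frame_def bij_betw_def)
  then have "inv_into (T 4) F (F v) = v" using v by simp
  then show ?thesis using realizes by (simp add: realizes_def)
qed

lemma rotation: "rotation_matrix (P l)"
proof (rule rotation_matrixI)
  note [simp] = holonomy_tangent act frame_inner[OF frame] frame_vol[OF curvature vertex frame]
  fix a b c
  obtain u v w where uvw: "u \<in> T 4" "F u = a" "v \<in> T 4" "F v = b" "w \<in> T 4" "F w = c"
    by (metis frame_surj[OF frame])
  show "(P l *v a) \<bullet> (P l *v b) = a \<bullet> b"
    using uvw holonomy_isometry[of l] by (auto simp: tangent_isometry_def)
  show "(P l *v a) \<bullet> cross3 (P l *v b) (P l *v c) = a \<bullet> cross3 b c"
    using uvw holonomy_isometry[of l] by (auto simp: tangent_isometry_def)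
qed

text \<open>In the composite of the four simple paths each edge is followed by its reverse, so the
  transports cancel in pairs.\<close>

lemma closed: "closed_rotations P"
proof -
  have "P 4 ** P 3 ** P 2 ** P 1 = mat 1"
  proof (rule matrix_eq[THEN iffD2], rule allI)
    fix a
    obtain v where v: "v \<in> T 4" "F v = a"
      by (metis frame_surj[OF frame])
    have "(P 4 ** P 3 ** P 2 ** P 1) *v a = P 4 *v (P 3 *v (P 2 *v (P 1 *v F v)))"
      by (simp add: v flip: matrix_vector_mul_assoc)
    also have "\<dots> = F (holonomy \<sigma> V 4 (holonomy \<sigma> V 3 (holonomy \<sigma> V 2 (holonomy \<sigma> V 1 v))))"
      by (simp add: act holonomy_tangent v(1) flip: v(2))
    also have "\<dots> = a"
      by (simp add: holonomy_eq t_back t_tangent v)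
    finally show "(P 4 ** P 3 ** P 2 ** P 1) *v a = mat 1 *v a" by simp
  qed
  then show ?thesis by (simp add: closed_rotations_def rotation)
qed

lemma tangent_n: "N 1 \<in> T 4" "N 2 \<in> T 4" "N 3 \<in> T 4" "t 4 2 (N 4) \<in> T 4"
  by (simp_all add: normal_tangent t_tangent)

lemma axes: "unit_axes P n"
proof -
  have "norm (n l) = 1" for l
    using exhaust_4[of l]
    by (auto simp: n_eq norm_eq_1 frame_inner[OF frame] tangent_n normal t_ip normal_tangent)
  moreover have "\<forall>l. P l *v n l = n l"
    unfolding forall_4 n_eq by (simp add: act tangent_n holonomy_eq t_normal t_back normal_tangent)
  ultimately show ?thesis by (simp add: unit_axes_def)
qed

text \<open>The first leg of path 1 undoes \<open>t 4 2\<close>, the second runs in face 4 and fixes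
  \<open>N 4\<close>; only the leg from vertex 3 remains.\<close>

lemma P1_n4: "P 1 *v n 4 = F (t 4 3 (N 4))"
  by (simp add: n_eq act tangent_n holonomy_eq t_back normal_tangent t_normal)

lemma P3_n4: "matrix_inv (P 3) *v n 4 = F (t 4 1 (N 4))"
proof -
  have "P 3 *v F (t 4 1 (N 4)) = n 4"
    by (simp add: n_eq act t_tangent normal_tangent holonomy_eq t_back t_normal)
  then show ?thesis
    using rotation_inv(2)[OF rotation] by metis
qed

text \<open>In every product with the fourth normal, that normal arrives along an edge lying in the
  other face, and this transport fixes the other normal.\<close>

lemma n_inner:
  "n 1 \<bullet> n 2 = ip \<sigma> (N 1) (N 2)" "n 1 \<bullet> n 3 = ip \<sigma> (N 1) (N 3)" "n 2 \<bullet> n 3 = ip \<sigma> (N 2) (N 3)"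
  "n 1 \<bullet> n 4 = ip \<sigma> (N 1) (N 4)" "n 3 \<bullet> n 4 = ip \<sigma> (N 3) (N 4)" "n 2 \<bullet> (P 1 *v n 4) = ip \<sigma> (N 2) (N 4)"
proof -
  have "ip \<sigma> (N k) (t 4 l (N 4)) = ip \<sigma> (N k) (N 4)" if "distinct [k, l, 4]" for k l
    using that t_ip[of l 4 "N k" "N 4"] t_normal[of k l 4] normal_tangent[of l k] normal_tangent[of l 4] by auto
  then show "n 1 \<bullet> n 2 = ip \<sigma> (N 1) (N 2)" "n 1 \<bullet> n 3 = ip \<sigma> (N 1) (N 3)" "n 2 \<bullet> n 3 = ip \<sigma> (N 2) (N 3)"
  "n 1 \<bullet> n 4 = ip \<sigma> (N 1) (N 4)" "n 3 \<bullet> n 4 = ip \<sigma> (N 3) (N 4)" "n 2 \<bullet> (P 1 *v n 4) = ip \<sigma> (N 2) (N 4)"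
    unfolding P1_n4 by (simp_all add: n_eq frame_inner[OF frame] tangent_n t_tangent normal_tangent)
qed

lemma even_vol: "vol (V 1) (V 3) (V 4) (V 2) < 0" "vol (V 2) (V 1) (V 4) (V 3) < 0" "vol (V 3) (V 2) (V 4) (V 1) < 0"
  "vol (V 2) (V 3) (V 1) (V 4) < 0" "vol (V 3) (V 1) (V 2) (V 4) < 0" "vol (V 4) (V 1) (V 3) (V 2) < 0"
  "vol (V 1) (V 2) (V 3) (V 4) < 0"
  using vol_neg by (simp_all add: vol_expand algebra_simps)

text \<open>Each condition involving \<open>n 4\<close> is a volume at \<open>V 4\<close> that
  transport moves to the vertex \<open>l\<close> from which \<open>N 4\<close> came, where
  \<open>normals_vol\<close> gives the sign.\<close>

lemma positive: "positive_axes P n"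
proof -
  have key: "cross3 (F (N a)) (F (N b)) \<bullet> F (t 4 l (N 4)) > 0"
    if "distinct [a, b, l, 4]" "vol (V a) (V b) (V 4) (V l) < 0" for a b l
  proof -
    have "vol (N a) (N b) (t 4 l (N 4)) (V 4) = vol (t 4 l (N a)) (t 4 l (N b)) (t 4 l (N 4)) (V 4)"
      using that by (simp add: t_normal)
    also have "\<dots> = vol (N a) (N b) (N 4) (V l)"
      by (rule t_vol) (use that in \<open>auto intro!: normal_tangent\<close>)
    also have "\<dots> > 0"
      by (rule normals_vol) (use that in auto)
    finally show ?thesis
      by (subst frame_triple[OF curvature vertex frame]) (use that in \<open>auto intro!: normal_tangent t_tangent\<close>)
  qed
  have "cross3 (n 1) (n 2) \<bullet> n 3 > 0"
    unfolding n_eq by (subst frame_triple[OF curvature vertex frame]) (auto simp: tangent_n intro!: normals_vol even_vol)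
  then show ?thesis
    unfolding positive_axes_def triple_products_pos_iff P1_n4 P3_n4
    unfolding n_eq by (auto intro!: key even_vol axes[unfolded n_eq])
qed

text \<open>The base vertex \<open>a\<close> and its frame are variable because face 4 does not
  contain \<open>V 4\<close> and is treated from \<open>V 2\<close>.\<close>

lemma face:
  assumes d: "distinct [d, a, b, c]" and v: "vol (V d) (V b) (V c) (V a) < 0" and F': "oriented_frame \<sigma> (V a) F'"
    and act': "\<And>v. v \<in> T a \<Longrightarrow> P l *v F' v = F' (t a c (t c b (t b a v)))"
  shows "0 < triangle_area \<sigma> (V a) (V b) (V c) \<and> triangle_area \<sigma> (V a) (V b) (V c) < 2 * pi \<and>
    P l = matrix_exp ((\<sigma> * triangle_area \<sigma> (V a) (V b) (V c)) *\<^sub>R so3_generator (F' (N d)))"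
proof -
  have e: "edge \<sigma> (V a) (V b)" "edge \<sigma> (V b) (V c)" "edge \<sigma> (V c) (V a)"
    using d by (auto intro!: edges)
  have N: "ip \<sigma> (N d) (V a) = 0" "ip \<sigma> (N d) (V b) = 0" "ip \<sigma> (N d) (V c) = 0" "ip \<sigma> (N d) (N d) = 1"
    using d by (auto simp: normal)
  have pos: "vol (N d) (V b) (V c) (V a) > 0"
    by (rule normal_face_vol[OF v]) (use d in auto)
  show ?thesis
    using triangle_holonomy[OF e F' N pos rotation[of l]] triangle_area_holonomy[OF e F' N pos] act'
    by (simp add: edge_transport_def)
qed

lemma areas: "0 < face_area \<sigma> V l \<and> face_area \<sigma> V l < 2 * pi \<and>
    P l = matrix_exp ((\<sigma> * face_area \<sigma> V l) *\<^sub>R so3_generator (n l))"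
proof -
  have area: "face_area \<sigma> V 1 = triangle_area \<sigma> (V 4) (V 2) (V 3)" "face_area \<sigma> V 2 = triangle_area \<sigma> (V 4) (V 3) (V 1)"
    "face_area \<sigma> V 3 = triangle_area \<sigma> (V 4) (V 1) (V 2)" "face_area \<sigma> V 4 = triangle_area \<sigma> (V 2) (V 1) (V 3)"
    by (simp_all add: face_area_def) (metis triangle_area_perm)+
  \<comment> \<open>On the tangent space at \<open>V 2\<close> this frame is \<open>F\<close> after
    \<open>t 4 2\<close>, so it absorbs the detour along the special edge and \<open>P 4\<close>
    becomes a plain triangle loop.\<close>
  let ?F2 = "F \<circ> mirror \<sigma> (V 4 + V 2)"
  have e: "edge \<sigma> (V 4) (V 2)" by (rule edges) simp
  have F2: "oriented_frame \<sigma> (V 2) ?F2"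
    by (rule frame_transport[OF e frame])
  have F2_eq: "?F2 v = F (t 4 2 v)" if "v \<in> T 2" for v
    using transport_eq_mirror[OF edge_sym[OF e] that] by (simp add: edge_transport_def add.commute)
  have "P 4 *v ?F2 v = ?F2 (t 2 3 (t 3 1 (t 1 2 v)))" if "v \<in> T 2" for v
    unfolding F2_eq[OF that] using that
    by (subst F2_eq) (simp_all add: act t_tangent holonomy_eq t_back)
  note f4 = face[of 4 2 1 3, OF _ even_vol(6) F2 this]
  have "\<forall>l. 0 < face_area \<sigma> V l \<and> face_area \<sigma> V l < 2 * pi \<and>
    P l = matrix_exp ((\<sigma> * face_area \<sigma> V l) *\<^sub>R so3_generator (n l))"
    unfolding forall_4 area n_eq
  proof (intro conjI[of "_ \<and> _" "_ \<and> _"])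
    show "0 < triangle_area \<sigma> (V 4) (V 2) (V 3) \<and> triangle_area \<sigma> (V 4) (V 2) (V 3) < 2 * pi \<and>
      P 1 = matrix_exp ((\<sigma> * triangle_area \<sigma> (V 4) (V 2) (V 3)) *\<^sub>R so3_generator (F (N 1)))"
      by (rule face[OF _ even_vol(7) frame]) (simp_all add: act holonomy_eq)
    show "0 < triangle_area \<sigma> (V 4) (V 3) (V 1) \<and> triangle_area \<sigma> (V 4) (V 3) (V 1) < 2 * pi \<and>
      P 2 = matrix_exp ((\<sigma> * triangle_area \<sigma> (V 4) (V 3) (V 1)) *\<^sub>R so3_generator (F (N 2)))"
      by (rule face[OF _ even_vol(4) frame]) (simp_all add: act holonomy_eq)
    show "0 < triangle_area \<sigma> (V 4) (V 1) (V 2) \<and> triangle_area \<sigma> (V 4) (V 1) (V 2) < 2 * pi \<and>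
      P 3 = matrix_exp ((\<sigma> * triangle_area \<sigma> (V 4) (V 1) (V 2)) *\<^sub>R so3_generator (F (N 3)))"
      by (rule face[OF _ even_vol(5) frame]) (simp_all add: act holonomy_eq)
    show "0 < triangle_area \<sigma> (V 2) (V 1) (V 3) \<and> triangle_area \<sigma> (V 2) (V 1) (V 3) < 2 * pi \<and>
      P 4 = matrix_exp ((\<sigma> * triangle_area \<sigma> (V 2) (V 1) (V 3)) *\<^sub>R so3_generator (F (t 4 2 (N 4))))"
      using f4 F2_eq[OF normal_tangent[of 2 4]] by simp
  qed
  then show ?thesis by blast
qed

end

lemma realizes_realization: "realizes \<sigma> V F P \<Longrightarrow> realization \<sigma> V F P"
  by (intro realization.intro realization_axioms.intro realizes_framed)

section \<open>Uniqueness\<close>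

text \<open>The matrix of products of normals with vertices is diagonal with negative
  entries.\<close>

lemma (in framed_tetrahedron) normals_independent: "vol (N 1) (N 2) (N 3) (N 4) \<noteq> 0"
proof
  assume "vol (N 1) (N 2) (N 3) (N 4) = 0"
  then have "\<sigma> * (vol (N 1) (N 2) (N 3) (N 4) * vol (V 1) (V 2) (V 3) (V 4)) = 0" by simp
  then have "ip \<sigma> (N 1) (V 1) * (ip \<sigma> (N 2) (V 2) * (ip \<sigma> (N 3) (V 3) * ip \<sigma> (N 4) (V 4))) = 0"
    unfolding vol_mult_vol det_4 vector_nth_4 by (simp add: normal_orthogonal)
  then show False
    using normal(3)[of 1] normal(3)[of 2] normal(3)[of 3] normal(3)[of 4] by simp
qed

lemma vol_coordinates:
  assumes "vol a b c d \<noteq> 0"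
  obtains p q r s where "x = p *\<^sub>R a + q *\<^sub>R b + r *\<^sub>R c + s *\<^sub>R d"
proof -
  define k where "k = 1 / vol a b c d"
  have "x = k *\<^sub>R (vol a b c d *\<^sub>R x)" using assms by (simp add: k_def)
  also have "\<dots> = (k * vol x b c d) *\<^sub>R a + (k * vol a x c d) *\<^sub>R b + (k * vol a b x d) *\<^sub>R c + (k * vol a b c x) *\<^sub>R d"
    unfolding cramer[of x b c d a, symmetric] by (simp add: scaleR_add_right)
  finally show ?thesis using that by blast
qed

text \<open>The axes of both tetrahedra are positive axes of the same rotations, so they coincide as
  vectors even if the frames differ.\<close>

lemma same_axes_same_gram:
  assumes "realization \<sigma> V F P" "realization \<sigma>' V' F' P" "\<forall>l. P l \<noteq> mat 1"
  shows "ip \<sigma> (outward_normal \<sigma> V l) (outward_normal \<sigma> V m) = ip \<sigma>' (outward_normal \<sigma>' V' l) (outward_normal \<sigma>' V' m)"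
proof -
  interpret R: realization \<sigma> V F P by fact
  interpret R': realization \<sigma>' V' F' P by fact
  have n: "R'.n = R.n"
    using positive_axes_unique[OF R.closed assms(3) R'.positive R.positive] .
  let ?E = "\<lambda>l m. ip \<sigma> (R.N l) (R.N m) = ip \<sigma>' (R'.N l) (R'.N m)"
  have e: "?E 1 2" "?E 1 3" "?E 2 3" "?E 1 4" "?E 2 4" "?E 3 4"
    using R.n_inner R'.n_inner unfolding n by simp_all
  have sym: "?E l m \<Longrightarrow> ?E m l" for l m
    by (metis ip_commute)
  have "\<forall>l m. ?E l m"
    unfolding forall_4 using e e[THEN sym] R.normal(1) R'.normal(1) by simp
  then show ?thesis by blast
qed

text \<open>The coefficients of the timelike vector \<open>V' 4\<close> in one set of normals, used
  with the other set, would produce a vector of square -1 in Euclidean space.\<close>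

lemma same_gram_curvature:
  assumes "framed_tetrahedron \<sigma> V F" "framed_tetrahedron \<sigma>' V' F'"
    and gram: "\<And>l m. ip \<sigma> (outward_normal \<sigma> V l) (outward_normal \<sigma> V m) = ip \<sigma>' (outward_normal \<sigma>' V' l) (outward_normal \<sigma>' V' m)"
    and \<sigma>: "\<sigma> = 1"
  shows "\<sigma>' = 1"
proof (rule ccontr)
  interpret T: framed_tetrahedron \<sigma> V F by fact
  interpret T': framed_tetrahedron \<sigma>' V' F' by fact
  assume "\<sigma>' \<noteq> 1"
  then have \<sigma>': "\<sigma>' = -1" using T'.curvature by blast
  obtain p q r s where x: "V' 4 = p *\<^sub>R T'.N 1 + q *\<^sub>R T'.N 2 + r *\<^sub>R T'.N 3 + s *\<^sub>R T'.N 4"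
    using vol_coordinates[OF T'.normals_independent] .
  let ?y = "p *\<^sub>R T.N 1 + q *\<^sub>R T.N 2 + r *\<^sub>R T.N 3 + s *\<^sub>R T.N 4"
  have "ip \<sigma>' (V' 4) (V' 4) = ip \<sigma> ?y ?y"
    unfolding x by (simp add: gram)
  moreover have "ip \<sigma> ?y ?y \<ge> 0"
    unfolding \<sigma> ip_expand by simp
  ultimately show False
    using T'.vertex[of 4] by (simp add: model_space_def \<sigma>')
qed

text \<open>\<open>L\<close> is defined on the normals, where equality of the Gram matrices makes it
  an isometry. It carries vertices to vertices because \<open>V l\<close> is orthogonal to three
  normals, and its square and the sign of its product with \<open>N l\<close> fix the scale.\<close>

lemma same_gram_isometric:
  assumes "framed_tetrahedron \<sigma> V F" "framed_tetrahedron \<sigma> V' F'"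
    and gram: "\<And>l m. ip \<sigma> (outward_normal \<sigma> V l) (outward_normal \<sigma> V m) = ip \<sigma> (outward_normal \<sigma> V' l) (outward_normal \<sigma> V' m)"
  shows "\<exists>L. isometry_matrix \<sigma> L \<and> (\<forall>l. L *v V l = V' l)"
proof -
  interpret T: framed_tetrahedron \<sigma> V F by fact
  interpret T': framed_tetrahedron \<sigma> V' F' by fact
  define A B where "A = transpose (vector [T.N 1, T.N 2, T.N 3, T.N 4] :: real^4^4)"
    and "B = transpose (vector [T'.N 1, T'.N 2, T'.N 3, T'.N 4] :: real^4^4)"
  define L where "L = B ** matrix_inv A"
  have ax: "A *v axis l 1 = T.N l" "B *v axis l 1 = T'.N l" for l
    using exhaust_4[of l] by (auto simp: A_def B_def matrix_vector_mult_basis column_transpose row_def)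
  have "invertible A"
    using T.normals_independent by (simp add: invertible_det_nz A_def vol_def)
  then have A_inv: "matrix_inv A ** A = mat 1"
    unfolding invertible_def matrix_inv_def by (rule someI2_ex) blast
  then have "matrix_inv A *v T.N l = axis l 1" for l
    by (metis ax(1) A_inv matrix_vector_mul_assoc matrix_vector_mul_lid)
  then have LN: "L *v T.N l = T'.N l" for l
    by (simp add: L_def ax flip: matrix_vector_mul_assoc)
  have ipL: "ip \<sigma> (L *v x) (L *v y) = ip \<sigma> x y" for x y
  proof -
    obtain p q r s where x: "x = p *\<^sub>R T.N 1 + q *\<^sub>R T.N 2 + r *\<^sub>R T.N 3 + s *\<^sub>R T.N 4"
      using vol_coordinates[OF T.normals_independent] .
    obtain p' q' r' s' where y: "y = p' *\<^sub>R T.N 1 + q' *\<^sub>R T.N 2 + r' *\<^sub>R T.N 3 + s' *\<^sub>R T.N 4"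
      using vol_coordinates[OF T.normals_independent] .
    show ?thesis
      unfolding x y by (simp add: matrix_vector_right_distrib matrix_vector_mult_scaleR LN gram)
  qed
  have LV: "L *v V l = V' l" for l
  proof -
    let ?y = "L *v V l"
    have y: "ip \<sigma> (T'.N m) ?y = ip \<sigma> (T.N m) (V l)" for m
      using ipL[of "T.N m" "V l"] by (simp add: LN)
    define a b where "a = ip \<sigma> (T'.N l) ?y" and "b = ip \<sigma> (T'.N l) (V' l)"
    have neg: "a < 0" "b < 0" using T.normal(3)[of l] T'.normal(3)[of l] by (simp_all add: a_def b_def y)
    have "ip \<sigma> (b *\<^sub>R ?y - a *\<^sub>R V' l) (T'.N m) = 0" for m
      by (cases "m = l") (simp_all add: a_def b_def ip_commute[of \<sigma> _ "T'.N _"], simp add: y T.normal_orthogonal T'.normal_orthogonal)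
    then have "b *\<^sub>R ?y - a *\<^sub>R V' l = 0"
      by (intro vol_nonzero_imp_zero[OF _ T'.normals_independent, of \<sigma>]) (use T.curvature in auto)
    then have eq: "b *\<^sub>R ?y = a *\<^sub>R V' l" by simp
    have "b\<^sup>2 * ip \<sigma> ?y ?y = a\<^sup>2 * ip \<sigma> (V' l) (V' l)"
      using arg_cong[OF eq, of "\<lambda>z. ip \<sigma> z z"] by (simp add: power2_eq_square ac_simps)
    then have "b\<^sup>2 = a\<^sup>2"
      using T.vertex[of l] T'.vertex[of l] T.curvature by (auto simp: ipL model_space_def)
    with neg have "b = a" by (auto simp: power2_eq_iff)
    with eq neg show ?thesis by simp
  qed
  \<comment> \<open>Equal Gram matrices give vertex volumes of equal square; both are negative, so
    orientation rules out determinant -1.\<close>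
  have "ip \<sigma> (V' l) (V' m) = ip \<sigma> (V l) (V m)" for l m
    using ipL[of "V l" "V m"] by (simp add: LV)
  then have "\<sigma> * (vol (V' 1) (V' 2) (V' 3) (V' 4) * vol (V' 1) (V' 2) (V' 3) (V' 4))
      = \<sigma> * (vol (V 1) (V 2) (V 3) (V 4) * vol (V 1) (V 2) (V 3) (V 4))"
    unfolding vol_mult_vol by simp
  then have "(vol (V' 1) (V' 2) (V' 3) (V' 4))\<^sup>2 = (vol (V 1) (V 2) (V 3) (V 4))\<^sup>2"
    using T.curvature by (auto simp: power2_eq_square)
  then have "vol (V' 1) (V' 2) (V' 3) (V' 4) = vol (V 1) (V 2) (V 3) (V 4)"
    using T.vol_neg T'.vol_neg by (auto simp: power2_eq_iff)
  then have "det L = 1"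
    using vol_matrix[of L "V 1" "V 2" "V 3" "V 4"] T.vol_neg by (simp add: LV)
  with ipL LV show ?thesis
    unfolding isometry_matrix_def by blast
qed

lemma realizes_unique:
  assumes R: "realizes \<sigma> V F P" and R': "realizes \<sigma>' V' F' P" and ne: "\<forall>l. P l \<noteq> mat 1"
  shows "\<sigma> = \<sigma>' \<and> (\<exists>L. isometry_matrix \<sigma> L \<and> (\<forall>l. L *v V l = V' l))"
proof -
  note gram = same_axes_same_gram[OF realizes_realization[OF R] realizes_realization[OF R'] ne]
  have "\<sigma> = 1 \<longleftrightarrow> \<sigma>' = 1"
    using same_gram_curvature[OF realizes_framed[OF R] realizes_framed[OF R'] gram]
      same_gram_curvature[OF realizes_framed[OF R'] realizes_framed[OF R] gram[symmetric]] by blast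
  then have "\<sigma> = \<sigma>'"
    using R R' by (auto simp: realizes_def curved_tetrahedron_def)
  then show ?thesis
    using same_gram_isometric[OF realizes_framed[OF R]] realizes_framed[OF R'] gram by blast
qed

section \<open>Existence\<close>

text \<open>\<open>emb 0\<close> identifies \<open>real^3\<close> with the tangent space at the base
  point \<open>emb (-1) 0\<close>; \<open>s\<close> is the component along the distinguished
  axis.\<close>

definition emb :: "real \<Rightarrow> real^3 \<Rightarrow> real^4" where
  "emb s v = vector [s, v$1, v$2, v$3]"

definition proj :: "real^4 \<Rightarrow> real^3" where
  "proj x = vector [x$2, x$3, x$4]"

lemma ip_emb: "ip \<sigma> (emb s v) (emb s' w) = \<sigma> * (s * s') + v \<bullet> w"
  by (simp add: ip_expand emb_def inner_vec_def sum_3)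

lemma proj_emb: "proj (emb s v) = v"
  by (simp add: proj_def emb_def vec_eq_iff forall_3)

lemma vol_emb: "vol (emb 0 a) (emb 0 b) (emb 0 c) (emb s v) = - s * (a \<bullet> cross3 b c)"
  by (simp add: vol_expand emb_def cross3_def inner_vec_def sum_3 algebra_simps)

text \<open>The sign of the base point compensates the sign in \<open>vol_emb\<close>.\<close>

lemma frame_proj:
  assumes "\<sigma> = 1 \<or> \<sigma> = -1"
  shows "oriented_frame \<sigma> (emb (-1) 0) proj"
proof -
  have T: "v \<in> tangent_space \<sigma> (emb (-1) 0) \<longleftrightarrow> v $ 1 = 0" for v
    using assms by (auto simp: tangent_space_def ip_expand emb_def)
  have E: "v = emb 0 (proj v)" if "v $ 1 = 0" for v
    using that by (simp add: emb_def proj_def vec_eq_iff forall_4)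
  have lin: "linear proj"
    by (rule linearI) (simp_all add: proj_def vec_eq_iff forall_3)
  have bij: "bij_betw proj (tangent_space \<sigma> (emb (-1) 0)) UNIV"
    by (rule bij_betw_byWitness[where f' = "emb 0"]) (auto simp: T proj_emb E[symmetric], simp add: emb_def)
  have ip: "proj v \<bullet> proj w = ip \<sigma> v w" if "v $ 1 = 0" "w $ 1 = 0" for v w
    using that by (simp add: proj_def ip_expand inner_vec_def sum_3)
  have or: "det (vector [proj u, proj v, proj w] :: real^3^3) = vol u v w (emb (-1) 0)"
    if "u $ 1 = 0" "v $ 1 = 0" "w $ 1 = 0" for u v w
    using vol_emb[of "proj u" "proj v" "proj w" "-1" 0] E that by (simp add: dot_cross_det)
  show ?thesis
    using lin bij ip or by (auto simp: oriented_frame_def T vol_def)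
qed

definition gram3 :: "real \<Rightarrow> real^4 \<Rightarrow> real^4 \<Rightarrow> real^4 \<Rightarrow> real" where
  "gram3 \<sigma> a b c = det (vector [vector [ip \<sigma> a a, ip \<sigma> a b, ip \<sigma> a c],
     vector [ip \<sigma> b a, ip \<sigma> b b, ip \<sigma> b c], vector [ip \<sigma> c a, ip \<sigma> c b, ip \<sigma> c c]] :: real^3^3)"

text \<open>Vectors of \<open>real^3\<close> with the same products serve as a model, in which the
  Gram determinant is the square of a triple product.\<close>

lemma gram3_pos:
  assumes "cross3 x y \<bullet> z \<noteq> 0" "ip \<sigma> a a = x \<bullet> x" "ip \<sigma> b b = y \<bullet> y" "ip \<sigma> c c = z \<bullet> z"
    "ip \<sigma> a b = x \<bullet> y" "ip \<sigma> a c = x \<bullet> z" "ip \<sigma> b c = y \<bullet> z"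
  shows "gram3 \<sigma> a b c > 0"
proof -
  have "gram3 \<sigma> a b c = (cross3 x y \<bullet> z)\<^sup>2"
    unfolding gram3_def det_3 vector_3 ip_commute[of \<sigma> b a] ip_commute[of \<sigma> c a] ip_commute[of \<sigma> c b] assms(2-)
      cross3_def inner_vec_def sum_3 inner_real_def power2_eq_square by algebra
  with assms(1) show ?thesis by simp
qed

text \<open>The determinant of \<open>metric \<sigma>\<close> has the sign of \<open>\<sigma>\<close>, so the normal to a positive definite
  hyperplane has squared length of that sign and can be scaled into the model space.\<close>

lemma dual_vertex:
  assumes \<sigma>: "\<sigma> = 1 \<or> \<sigma> = -1" and vol: "vol a b c d \<noteq> 0" and G: "gram3 \<sigma> b c d > 0"
  shows "\<exists>v\<in>model_space \<sigma>. ip \<sigma> a v < 0 \<and> ip \<sigma> b v = 0 \<and> ip \<sigma> c v = 0 \<and> ip \<sigma> d v = 0"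
proof -
  obtain u where u: "u \<noteq> 0" "ip \<sigma> u b = 0" "ip \<sigma> u c = 0" "ip \<sigma> u d = 0"
    using exists_orthogonal[OF \<sigma>] .
  then have u': "ip \<sigma> b u = 0" "ip \<sigma> c u = 0" "ip \<sigma> d u = 0" by (simp_all add: ip_commute)
  have ne: "ip \<sigma> a u \<noteq> 0"
  proof
    assume "ip \<sigma> a u = 0"
    then have "u = 0"
      using vol_nonzero_imp_zero[OF _ vol, of \<sigma> u] u \<sigma> by (auto simp: ip_commute)
    with u show False by simp
  qed
  have "\<sigma> * (vol a b c d * vol u b c d) = ip \<sigma> a u * gram3 \<sigma> b c d"
    unfolding vol_mult_vol gram3_def det_4 det_3 vector_nth_4 vector_3 using u'
    by (simp add: algebra_simps)
  with ne G have "vol u b c d \<noteq> 0" by auto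
  moreover have "\<sigma> * (vol u b c d * vol u b c d) = ip \<sigma> u u * gram3 \<sigma> b c d"
    unfolding vol_mult_vol gram3_def det_4 det_3 vector_nth_4 vector_3 using u'
    by (simp add: algebra_simps)
  then have "\<sigma> * ip \<sigma> u u * gram3 \<sigma> b c d = (vol u b c d)\<^sup>2"
    using \<sigma> by (auto simp: power2_eq_square)
  ultimately have pos: "\<sigma> * ip \<sigma> u u > 0"
    using G by (metis zero_less_power2 zero_less_mult_pos2)
  define k where "k = - sgn (ip \<sigma> a u) / sqrt (\<sigma> * ip \<sigma> u u)"
  have "k\<^sup>2 = 1 / (\<sigma> * ip \<sigma> u u)"
    using pos ne by (auto simp: k_def power_divide sgn_if)
  then have "k\<^sup>2 * ip \<sigma> u u = \<sigma>"
    using pos \<sigma> by (auto simp: field_simps)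
  moreover have "k * ip \<sigma> a u < 0"
    using pos ne by (auto simp: k_def sgn_if divide_simps)
  ultimately show ?thesis
    using u' by (intro bexI[of _ "k *\<^sub>R u"]) (simp_all add: model_space_def power2_eq_square mult.assoc)
qed

text \<open>The first three normals are the axes themselves, placed in the tangent space at the
  future vertex 4. The fourth is assembled from its prescribed products, and the vertices are then
  dual to the normals.\<close>

lemma exists_realizes:
  assumes P: "closed_rotations P" "gram_defined P" and G: "det (gram P) \<noteq> 0"
  shows "\<exists>\<sigma> V F. realizes \<sigma> V F P"
proof -
  define n where "n = signed_axes P"
  have pos: "positive_axes P n"
    unfolding n_def by (rule signed_axes_positive[OF P])
  have axes: "unit_axes P n" using pos by (simp add: positive_axes_def)
  have rot: "rotation_matrix (P l)" for l using P(1) by (simp add: closed_rotations_def)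
  have triple: "cross3 (n 1) (n 2) \<bullet> n 3 > 0" "cross3 (n 1) (n 3) \<bullet> n 4 > 0"
     "cross3 (n 2) (n 1) \<bullet> (P 1 *v n 4) > 0" "cross3 (n 3) (n 2) \<bullet> (matrix_inv (P 3) *v n 4) > 0"
    using pos by (simp_all add: positive_axes_def triple_products_pos_iff)
  have unit: "n l \<bullet> n l = 1" and fix_n: "P l *v n l = n l" for l
    using axes by (simp_all add: unit_axes_def norm_eq_1)
  define D where "D = n 1 \<bullet> cross3 (n 2) (n 3)"
  have D: "D > 0" using triple(1) cross_triple[of "n 1" "n 2" "n 3"] by (simp add: D_def inner_commute)
  define g1 g2 g3 where "g1 = n 1 \<bullet> n 4" and "g2 = n 2 \<bullet> (P 1 *v n 4)" and "g3 = n 3 \<bullet> n 4"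
  \<comment> \<open>The cross products divided by \<open>D\<close> form the dual basis, so
    \<open>m\<close> is the vector with products \<open>g1\<close>, \<open>g2\<close>,
    \<open>g3\<close>.\<close>
  define m where "m = (1 / D) *\<^sub>R (g1 *\<^sub>R cross3 (n 2) (n 3) + g2 *\<^sub>R cross3 (n 3) (n 1) + g3 *\<^sub>R cross3 (n 1) (n 2))"
  have D': "n 2 \<bullet> cross3 (n 3) (n 1) = D" "n 3 \<bullet> cross3 (n 1) (n 2) = D"
    by (simp_all add: D_def cross3_simps)
  have m: "n 1 \<bullet> m = g1" "n 2 \<bullet> m = g2" "n 3 \<bullet> m = g3"
    using D by (simp_all add: m_def inner_add_right dot_cross_self D_def[symmetric] D')
  have mm: "m \<bullet> m \<noteq> 1"
  proof
    assume mm: "m \<bullet> m = 1"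
    define a b c where "a = (m \<bullet> cross3 (n 2) (n 3)) / D" and "b = (m \<bullet> cross3 (n 3) (n 1)) / D"
      and "c = (m \<bullet> cross3 (n 1) (n 2)) / D"
    have "D *\<^sub>R m = D *\<^sub>R (a *\<^sub>R n 1 + b *\<^sub>R n 2 + c *\<^sub>R n 3)"
      using triple_decomp[of "n 1" "n 2" "n 3" m] D
      by (simp add: a_def b_def c_def scaleR_add_right flip: D_def)
    then have comb: "m = a *\<^sub>R n 1 + b *\<^sub>R n 2 + c *\<^sub>R n 3"
      using D by (metis scaleR_cancel_left less_irrefl)
    have rel: "a * (n 1 \<bullet> n 1) + b * (n 1 \<bullet> n 2) + c * (n 1 \<bullet> n 3) = g1"
        "a * (n 2 \<bullet> n 1) + b * (n 2 \<bullet> n 2) + c * (n 2 \<bullet> n 3) = g2"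
        "a * (n 3 \<bullet> n 1) + b * (n 3 \<bullet> n 2) + c * (n 3 \<bullet> n 3) = g3"
      using m arg_cong[OF comb, of "\<lambda>z. n 1 \<bullet> z"] arg_cong[OF comb, of "\<lambda>z. n 2 \<bullet> z"] arg_cong[OF comb, of "\<lambda>z. n 3 \<bullet> z"]
      by (simp_all add: inner_add_right)
    have "a * g1 + b * g2 + c * g3 = 1"
      using mm arg_cong[OF comb, of "\<lambda>z. z \<bullet> m"] m by (simp add: inner_add_left)
    \<comment> \<open>If \<open>m\<close> had unit length, it could itself be the fourth normal, and
      its dependence on the axes would be a kernel vector of the Gram matrix.\<close>
    define y where "y = (vector [a, b, c, -1] :: real^4)"
    have "gram P *v y = 0"
      using rel \<open>a * g1 + b * g2 + c * g3 = 1\<close> unit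
      by (simp add: vec_eq_iff forall_4 matrix_vector_mult_def sum_4 gram_def Let_def n_def[symmetric] y_def
          g1_def g2_def g3_def inner_commute doubleton_eq_iff algebra_simps)
    moreover have "y \<noteq> 0" by (simp add: y_def vec_eq_iff forall_4)
    ultimately show False
      using G by (metis invertible_det_nz invertible_def matrix_left_invertible_ker)
  qed
  define \<sigma> :: real where "\<sigma> = (if m \<bullet> m < 1 then 1 else -1)"
  define s where "s = sqrt \<bar>1 - m \<bullet> m\<bar>"
  have \<sigma>: "\<sigma> = 1 \<or> \<sigma> = -1" by (simp add: \<sigma>_def)
  have s: "s > 0" "\<sigma> * (s * s) + m \<bullet> m = 1"
    using mm by (auto simp: s_def \<sigma>_def)
  \<comment> \<open>The factor \<open>\<sigma>\<close> makes the product of \<open>M 4\<close> with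
    the base point equal to \<open>- s\<close> for either curvature, as an outward normal
    requires.\<close>
  define M where "M = quad (emb 0 (n 1)) (emb 0 (n 2)) (emb 0 (n 3)) (emb (\<sigma> * s) m)"
  have Mq: "M 1 = emb 0 (n 1)" "M 2 = emb 0 (n 2)" "M 3 = emb 0 (n 3)" "M 4 = emb (\<sigma> * s) m"
    by (simp_all add: M_def)
  have ipM: "ip \<sigma> (M l) (M l) = 1" "ip \<sigma> (M 1) (M 2) = n 1 \<bullet> n 2" "ip \<sigma> (M 1) (M 3) = n 1 \<bullet> n 3" "ip \<sigma> (M 2) (M 3) = n 2 \<bullet> n 3"
    "ip \<sigma> (M 1) (M 4) = g1" "ip \<sigma> (M 2) (M 4) = g2" "ip \<sigma> (M 3) (M 4) = g3" for l
    using exhaust_4[of l] \<sigma> s(2) by (auto simp: Mq ip_emb unit m)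
  have volM: "vol (M 1) (M 2) (M 3) (M 4) \<noteq> 0"
    using D s(1) \<sigma> by (auto simp: Mq vol_emb simp flip: D_def)
  let ?x = "P 1 *v n 4" and ?z = "matrix_inv (P 3) *v n 4"
  have x: "n 1 \<bullet> ?x = g1" "n 2 \<bullet> ?x = g2" "?x \<bullet> ?x = 1"
    using rotation_inner[OF rot, of 1 "n 1" "n 4"] by (simp_all add: fix_n g1_def g2_def rotation_inner rot unit)
  have Pz: "P 3 *v ?z = n 4" by (rule rotation_inv(1)[OF rot])
  have z: "n 2 \<bullet> ?z = g2" "n 3 \<bullet> ?z = g3" "?z \<bullet> ?z = 1"
    using gram_24_alt[OF rot _ axes] P(1) rotation_inner[OF rot, of 3 "n 3" ?z] rotation_inner[OF rot, of 3 ?z ?z]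
    by (simp_all add: Pz fix_n g2_def g3_def unit closed_rotations_def)
  \<comment> \<open>Each triple has a model in \<open>real^3\<close> in which \<open>M 4\<close> is
    represented by \<open>?z\<close>, \<open>n 4\<close> or \<open>?x\<close> respectively; these
    are the triples of the last three sign conditions.\<close>
  have G3: "gram3 \<sigma> (M 3) (M 2) (M 4) > 0" "gram3 \<sigma> (M 1) (M 3) (M 4) > 0" "gram3 \<sigma> (M 2) (M 1) (M 4) > 0"
    using triple gram3_pos[of "n 3" "n 2" ?z \<sigma> "M 3" "M 2" "M 4"] gram3_pos[of "n 1" "n 3" "n 4" \<sigma> "M 1" "M 3" "M 4"]
      gram3_pos[of "n 2" "n 1" ?x \<sigma> "M 2" "M 1" "M 4"]
    by (simp_all add: ipM unit x z g1_def[symmetric] g3_def[symmetric] inner_commute[of "n 2" "n 1"] inner_commute[of "n 3" "n 2"]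
        ip_commute[of \<sigma> "M 2" "M 1"] ip_commute[of \<sigma> "M 3" "M 2"])
  have "vol (M 1) (M 3) (M 2) (M 4) = - vol (M 1) (M 2) (M 3) (M 4)" "vol (M 2) (M 1) (M 3) (M 4) = - vol (M 1) (M 2) (M 3) (M 4)"
    "vol (M 3) (M 2) (M 1) (M 4) = - vol (M 1) (M 2) (M 3) (M 4)"
    by (simp_all add: vol_expand algebra_simps)
  with volM have vM: "vol (M 1) (M 3) (M 2) (M 4) \<noteq> 0" "vol (M 2) (M 1) (M 3) (M 4) \<noteq> 0" "vol (M 3) (M 2) (M 1) (M 4) \<noteq> 0"
    by simp_all
  obtain v1 where v1: "v1 \<in> model_space \<sigma>" "ip \<sigma> (M 1) v1 < 0" "ip \<sigma> (M 2) v1 = 0" "ip \<sigma> (M 3) v1 = 0" "ip \<sigma> (M 4) v1 = 0"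
    using dual_vertex[OF \<sigma> vM(1) G3(1)] by blast
  obtain v2 where v2: "v2 \<in> model_space \<sigma>" "ip \<sigma> (M 2) v2 < 0" "ip \<sigma> (M 1) v2 = 0" "ip \<sigma> (M 3) v2 = 0" "ip \<sigma> (M 4) v2 = 0"
    using dual_vertex[OF \<sigma> vM(2) G3(2)] by blast
  obtain v3 where v3: "v3 \<in> model_space \<sigma>" "ip \<sigma> (M 3) v3 < 0" "ip \<sigma> (M 1) v3 = 0" "ip \<sigma> (M 2) v3 = 0" "ip \<sigma> (M 4) v3 = 0"
    using dual_vertex[OF \<sigma> vM(3) G3(3)] by blast
  define V where "V = quad v1 v2 v3 (emb (-1) 0)"
  have v4: "emb (-1) 0 \<in> model_space \<sigma>" "ip \<sigma> (M 1) (emb (-1) 0) = 0" "ip \<sigma> (M 2) (emb (-1) 0) = 0"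
     "ip \<sigma> (M 3) (emb (-1) 0) = 0" "ip \<sigma> (M 4) (emb (-1) 0) < 0"
    using \<sigma> s(1) by (auto simp: model_space_def Mq ip_emb)
  have V: "V 1 = v1" "V 2 = v2" "V 3 = v3" "V 4 = emb (-1) 0" by (simp_all add: V_def)
  have MV: "ip \<sigma> (M l) (V k) = 0" if "k \<noteq> l" for k l
    using exhaust_4[of k] exhaust_4[of l] that v1 v2 v3 v4 by (auto simp: V)
  have MV_neg: "ip \<sigma> (M l) (V l) < 0" for l
    using exhaust_4[of l] v1 v2 v3 v4 by (auto simp: V)
  have framed: "framed_tetrahedron \<sigma> V proj"
  proof
    show "V l \<in> model_space \<sigma>" for l
      using exhaust_4[of l] v1 v2 v3 v4 by (auto simp: V)
    then have "ip \<sigma> (V 4) (V 4) = \<sigma>" by (simp add: model_space_def)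
    \<comment> \<open>Duality again: three negative products against the volume \<open>D > 0\<close>
      of the first three axes force the path orientation.\<close>
    then have "\<sigma> * (vol (M 1) (M 2) (M 3) (V 4) * vol (V 1) (V 2) (V 3) (V 4))
        = \<sigma> * (ip \<sigma> (M 1) (V 1) * (ip \<sigma> (M 2) (V 2) * ip \<sigma> (M 3) (V 3)))"
      unfolding vol_mult_vol det_4 vector_nth_4 by (simp add: MV)
    then have "vol (M 1) (M 2) (M 3) (V 4) * vol (V 1) (V 2) (V 3) (V 4)
        = ip \<sigma> (M 1) (V 1) * (ip \<sigma> (M 2) (V 2) * ip \<sigma> (M 3) (V 3))"
      using \<sigma> by auto
    also have "\<dots> < 0"
      using MV_neg[of 1] MV_neg[of 2] MV_neg[of 3] by (simp add: mult_neg_neg mult_neg_pos)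
    also have "vol (M 1) (M 2) (M 3) (V 4) = D"
      by (simp add: Mq V vol_emb D_def)
    finally show "vol (V 1) (V 2) (V 3) (V 4) < 0"
      using D by (simp add: mult_less_0_iff)
    show "oriented_frame \<sigma> (V 4) proj"
      using frame_proj[OF \<sigma>] by (simp add: V)
  qed (rule \<sigma>)
  then interpret framed_tetrahedron \<sigma> V proj .
  have N: "N l = M l" for l
    by (rule normal_eqI) (use ipM MV MV_neg in auto)
  obtain Q where Q: "realizes \<sigma> V proj Q"
    using realizes_exists by blast
  interpret R: realization \<sigma> V proj Q
    by (rule realizes_realization[OF Q])
  have "P = Q"
  proof (rule positive_axes_determine[OF P(1) pos R.closed R.positive])
    show "R.n 1 = n 1" "R.n 2 = n 2" "R.n 3 = n 3"
      by (simp_all add: R.n_eq N Mq proj_emb)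
    show "R.n 1 \<bullet> R.n 4 = n 1 \<bullet> n 4" "R.n 3 \<bullet> R.n 4 = n 3 \<bullet> n 4" "R.n 2 \<bullet> (Q 1 *v R.n 4) = n 2 \<bullet> (P 1 *v n 4)"
      by (simp_all add: R.n_inner N ipM g1_def g2_def g3_def)
  qed
  with Q show ?thesis by blast
qed

theorem theorem1:
  fixes Os P :: "4 \<Rightarrow> real^3^3" and c :: couple
  assumes "\<forall>l. rotation_matrix (Os l)"
    and "Os 4 ** Os 3 ** Os 2 ** Os 1 = mat 1"
    and "P = relabel c Os"
    and "gram_defined P"
    and "det (gram P) \<noteq> 0"
  shows "(\<exists>\<sigma> V F. realizes \<sigma> V F P)
    \<and> (\<forall>\<sigma> V F. realizes \<sigma> V F P \<longrightarrow>
         (\<forall>l. 0 < face_area \<sigma> V l \<and> face_area \<sigma> V l < 2 * pi \<and>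
              P l = matrix_exp ((\<sigma> * face_area \<sigma> V l) *\<^sub>R
                      so3_generator (F (transported_normal \<sigma> V l)))))
    \<and> (\<forall>\<sigma> V F \<sigma>' V' F'. realizes \<sigma> V F P \<and> realizes \<sigma>' V' F' P \<longrightarrow>
         \<sigma> = \<sigma>' \<and> (\<exists>L. isometry_matrix \<sigma> L \<and> (\<forall>l. L *v V l = V' l)))"
proof (intro conjI[of "Ex _"] conjI[of "All _"])
  have closed: "closed_rotations P"
    using relabel_closed assms(1-3) by blast
  show "\<exists>\<sigma> V F. realizes \<sigma> V F P"
    by (rule exists_realizes[OF closed assms(4,5)])
  show "\<forall>\<sigma> V F. realizes \<sigma> V F P \<longrightarrow>
         (\<forall>l. 0 < face_area \<sigma> V l \<and> face_area \<sigma> V l < 2 * pi \<and>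
              P l = matrix_exp ((\<sigma> * face_area \<sigma> V l) *\<^sub>R
                      so3_generator (F (transported_normal \<sigma> V l))))"
    using realization.areas[OF realizes_realization] realization.n_def[OF realizes_realization] by metis
  have "\<forall>l. P l \<noteq> mat 1"
    using assms(4) by (simp add: gram_defined_def)
  then show "\<forall>\<sigma> V F \<sigma>' V' F'. realizes \<sigma> V F P \<and> realizes \<sigma>' V' F' P \<longrightarrow>
         \<sigma> = \<sigma>' \<and> (\<exists>L. isometry_matrix \<sigma> L \<and> (\<forall>l. L *v V l = V' l))"
    using realizes_unique by blast
qed

end
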